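(* Let $X$ be a finite-dimensional inner product space over $\mathbb{R}$ (real case) or over $\mathbb{C}$ with Hermitian product (complex case). Given any subspaces $V,W\subset X$, \[ \pi_{V,W}= \begin{cases} \cos \Theta_{V,W} & \text{in the real case,} \\ \cos^2 \Theta_{V,W} & \text{in the complex case,} \end{cases} \] where $\pi_{V,W}$ is the projection factor of $V$ on $W$ and $\Theta_{V,W}$ is the Grassmann angle of $V$ with $W$.
   Context: Subspaces and dimension are taken over the same field as $X$. A complex space is also regarded as a real inner product space with inner product $\operatorname{Re}\langle\cdot,\cdot\rangle$. On any subspace $U\subset X$, $|\cdot|_m$ denotes the $m$-dimensional Lebesgue measure of $U$ if $m=\dim_{\mathbb{R}} U$, and $|\cdot|_m=0$ if $m>\dim_{\mathbb{R}}U$. Projection factor: let $P:V\to W$ be the orthogonal projection and $d=\dim_{\mathbb{R}}V$; then $\pi_{V,W}=|P(S)|_d/|S|_d$, where $S$ is any Lebesgue measurable subset of $V$ with $|S|_d\neq 0$ and $|P(S)|_d$ is taken in the subspace $P(V)$ (the ratio does not depend on $S$). Principal angles: for nonzero $V,W$ with $p=\dim V$, $q=\dim W$, $m=\min\{p,q\}$, a singular value decomposition of $P:V\to W$ gives orthonormal (principal) bases $(e_1,\ldots,e_p)$ of $V$ and $(f_1,\ldots,f_q)$ of $W$ in which $P$ is represented by a $q\times p$ diagonal matrix with real diagonal entries $1\ge\sigma_1\ge\cdots\ge\sigma_m\ge0$, so $\langle e_i,f_j\rangle=0$ for $i\ne j$ and $\langle e_i,f_i\rangle=\sigma_i$. The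 principal angles $0\le\theta_1\le\cdots\le\theta_m\le\frac{\pi}{2}$ of $V$ and $W$ are the angles between $e_i$ and $f_i$, given by $\cos\theta_i=\sigma_i$. Grassmann angle: for nonzero $V,W$, $\Theta_{V,W}\in[0,\frac{\pi}{2}]$ is $\arccos(\cos\theta_1\cdots\cos\theta_p)$ if $p\le q$, and $\frac{\pi}{2}$ if $p>q$. Also $\Theta_{\{0\},\{0\}}=\Theta_{\{0\},W}=0$, and $\Theta_{V,\{0\}}=\frac{\pi}{2}$ for $V\neq\{0\}$. *)

theory Defs
  imports "HOL-Analysis.Analysis"
begin

text \<open>
  A complex vector space with a Hermitian inner product, linear in the first argument. Its
  underlying real inner product space is the superclass structure; positive definiteness of
  \<open>cinner\<close> follows from that of \<open>inner\<close>, since Hermitian symmetry makes \<open>cinner x x\<close> real.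
\<close>

class complex_inner = real_inner +
  fixes scaleC :: "complex \<Rightarrow> 'a \<Rightarrow> 'a"  (infixr \<open>*\<^sub>C\<close> 75)
    and cinner :: "'a \<Rightarrow> 'a \<Rightarrow> complex"
  assumes scaleC_add_right: "c *\<^sub>C (x + y) = c *\<^sub>C x + c *\<^sub>C y"
    and scaleC_add_left: "(c + d) *\<^sub>C x = c *\<^sub>C x + d *\<^sub>C x"
    and scaleC_scaleC: "c *\<^sub>C d *\<^sub>C x = (c * d) *\<^sub>C x"
    and scaleC_of_real: "complex_of_real r *\<^sub>C x = r *\<^sub>R x"
    and cinner_commute: "cinner y x = cnj (cinner x y)"
    and cinner_add_left: "cinner (x + y) z = cinner x z + cinner y z"
    and cinner_scaleC_left: "cinner (c *\<^sub>C x) y = c * cinner x y"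
    and inner_eq_Re_cinner: "x \<bullet> y = Re (cinner x y)"

global_interpretation complex_vector: vector_space "scaleC :: complex \<Rightarrow> 'a \<Rightarrow> 'a::complex_inner"
proof
  fix x :: 'a
  show "1 *\<^sub>C x = x"
    using scaleC_of_real[of 1 x] by simp
qed (simp_all add: scaleC_add_right scaleC_add_left scaleC_scaleC)

instantiation complex :: complex_inner
begin

definition scaleC_complex :: "complex \<Rightarrow> complex \<Rightarrow> complex"
  where "scaleC_complex c x = c * x"

definition cinner_complex :: "complex \<Rightarrow> complex \<Rightarrow> complex"
  where "cinner_complex x y = x * cnj y"

instance
  by standard
    (simp_all add: scaleC_complex_def cinner_complex_def algebra_simps scaleR_conv_of_real
      inner_complex_def)

end

instantiation vec :: (complex_inner, finite) complex_inner
begin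

definition scaleC_vec :: "complex \<Rightarrow> 'a ^ 'b \<Rightarrow> 'a ^ 'b"
  where "scaleC_vec c x = (\<chi> i. c *\<^sub>C (x $ i))"

definition cinner_vec :: "'a ^ 'b \<Rightarrow> 'a ^ 'b \<Rightarrow> complex"
  where "cinner_vec x y = (\<Sum>i\<in>UNIV. cinner (x $ i) (y $ i))"

instance
proof
  fix x y :: "'a ^ 'b"
  show "cinner y x = cnj (cinner x y)"
    unfolding cinner_vec_def cnj_sum by (intro sum.cong refl cinner_commute)
qed (simp_all add: scaleC_vec_def cinner_vec_def vec_eq_iff scaleC_add_right scaleC_add_left
    scaleC_scaleC scaleC_of_real cinner_add_left cinner_scaleC_left sum.distrib sum_distrib_left
    inner_vec_def inner_eq_Re_cinner)

end

text \<open>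
  The notions below are parametrised by the scalar multiplication and the inner product, so that
  they apply with \<open>scaleR\<close>, \<open>inner\<close> in the real case and with \<open>scaleC\<close>, \<open>cinner\<close> in the complex
  case. Bases are lists, indexed from 0.
\<close>

definition orthonormal_basis ::
    "('k::real_normed_field \<Rightarrow> 'a::real_inner \<Rightarrow> 'a) \<Rightarrow> ('a \<Rightarrow> 'a \<Rightarrow> 'k) \<Rightarrow> 'a set \<Rightarrow> 'a list \<Rightarrow> bool"
  where "orthonormal_basis smul ip U b \<longleftrightarrow>
    (\<forall>i<length b. \<forall>j<length b. ip (b ! i) (b ! j) = (if i = j then 1 else 0)) \<and>
    module.span smul (set b) = U"

definition orthogonal_projection ::
    "('a \<Rightarrow> 'a \<Rightarrow> 'k::real_normed_field) \<Rightarrow> 'a set \<Rightarrow> 'a::real_inner \<Rightarrow> 'a"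
  where "orthogonal_projection ip W x = (THE y. y \<in> W \<and> (\<forall>w\<in>W. ip (x - y) w = 0))"

text \<open>
  Lebesgue measure of a finite-dimensional subspace \<open>U\<close>, with the Lebesgue measurable subsets of
  \<open>U\<close> as measurable sets: Lebesgue measure on real coordinate space, transported by the linear
  isometry given by some real orthonormal basis. For \<open>U = {0}\<close> this is the counting measure.
\<close>

definition subspace_lebesgue :: "'a::real_inner set \<Rightarrow> 'a measure"
  where "subspace_lebesgue U =
    (let b = (SOME b. orthonormal_basis (*\<^sub>R) (\<bullet>) U b)
     in embed_measure (completion (\<Pi>\<^sub>M i\<in>{..<length b}. (lborel :: real measure)))
          (\<lambda>x. \<Sum>i<length b. x i *\<^sub>R b ! i))"

text \<open>
  The \<open>m\<close>-dimensional measure on \<open>U\<close>. It is only meant for \<open>m\<close> at least the real dimension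
  \<open>dim U\<close>; the value 0 for smaller \<open>m\<close> is arbitrary.
\<close>

definition subspace_volume :: "nat \<Rightarrow> 'a::real_inner set \<Rightarrow> 'a set \<Rightarrow> real"
  where "subspace_volume m U S = (if m = dim U then measure (subspace_lebesgue U) S else 0)"

text \<open>
  The common value of \<open>|P S| / |S|\<close> over all measurable \<open>S\<close> of nonzero finite measure;
  \<open>dim\<close> is the real dimension, also in the complex case.
\<close>

definition projection_factor ::
    "('a \<Rightarrow> 'a \<Rightarrow> 'k::real_normed_field) \<Rightarrow> 'a::real_inner set \<Rightarrow> 'a set \<Rightarrow> real"
  where "projection_factor ip V W =
    (let P = orthogonal_projection ip W; d = dim V
     in THE r. \<forall>S\<in>fmeasurable (subspace_lebesgue V). subspace_volume d V S \<noteq> 0 \<longrightarrow>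
          r = subspace_volume d (P ` V) (P ` S) / subspace_volume d V S)"

text \<open>
  A singular value decomposition of the orthogonal projection \<open>V \<rightarrow> W\<close>: in the orthonormal bases
  \<open>e\<close> of \<open>V\<close> and \<open>f\<close> of \<open>W\<close> it is represented by the diagonal matrix with entries \<open>\<sigma>\<close>.
\<close>

definition principal_decomposition ::
    "('k::real_normed_field \<Rightarrow> 'a::real_inner \<Rightarrow> 'a) \<Rightarrow> ('a \<Rightarrow> 'a \<Rightarrow> 'k) \<Rightarrow> 'a set \<Rightarrow> 'a set \<Rightarrow>
      'a list \<Rightarrow> 'a list \<Rightarrow> real list \<Rightarrow> bool"
  where "principal_decomposition smul ip V W e f \<sigma> \<longleftrightarrow>
    orthonormal_basis smul ip V e \<and> orthonormal_basis smul ip W f \<and>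
    length \<sigma> = min (length e) (length f) \<and>
    sorted_wrt (\<ge>) \<sigma> \<and> (\<forall>s\<in>set \<sigma>. 0 \<le> s \<and> s \<le> 1) \<and>
    (\<forall>i<length e. orthogonal_projection ip W (e ! i) =
       (if i < length f then smul (of_real (\<sigma> ! i)) (f ! i) else 0))"

text \<open>The singular values, hence the angles, are the same for every decomposition.\<close>

definition principal_angles ::
    "('k::real_normed_field \<Rightarrow> 'a::real_inner \<Rightarrow> 'a) \<Rightarrow> ('a \<Rightarrow> 'a \<Rightarrow> 'k) \<Rightarrow> 'a set \<Rightarrow> 'a set \<Rightarrow> real list"
  where "principal_angles smul ip V W =
    map arccos (SOME \<sigma>. \<exists>e f. principal_decomposition smul ip V W e f \<sigma>)"

definition grassmann_angle ::
    "('k::real_normed_field \<Rightarrow> 'a::real_inner \<Rightarrow> 'a) \<Rightarrow> ('a \<Rightarrow> 'a \<Rightarrow> 'k) \<Rightarrow> 'a set \<Rightarrow> 'a set \<Rightarrow> real"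
  where "grassmann_angle smul ip V W =
    (if V = {0} then 0
     else if W = {0} then pi / 2
     else if vector_space.dim smul V \<le> vector_space.dim smul W
       then arccos (\<Prod>\<theta>\<leftarrow>principal_angles smul ip V W. cos \<theta>)
     else pi / 2)"

end

theory Submission
  imports Defs
begin

text \<open>
  The real and the complex case are treated together, in a locale for inner product spaces over a
  scalar field \<open>'k\<close> that has a finite real orthonormal basis \<open>units\<close>: this is \<open>[1]\<close> for the reals
  and \<open>[1, \<i>]\<close> for the complex numbers. The common result is
  \<open>\<pi> = cos \<Theta> ^ length units\<close>.

  Existence of a principal decomposition is not part of the definition of the principal angles and
  has to be proved. A pair of unit vectors \<open>e \<in> V\<close>, \<open>f \<in> W\<close> with maximal real inner product exists by
  compactness of the unit spheres; maximality forces every vector of \<open>V\<close> orthogonal to \<open>e\<close> to be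
  orthogonal to \<open>f\<close>, and vice versa, so that one can pass to the orthogonal complements of \<open>e\<close> in
  \<open>V\<close> and of \<open>f\<close> in \<open>W\<close> (lemma \<open>exists_svd\<close>).

  Given a principal decomposition, multiplying the bases by the elements of \<open>units\<close> gives real
  orthonormal bases in which the projection is still diagonal, with every singular value repeated
  \<open>length units\<close> times. If every vector of the basis of \<open>V\<close> has a positive diagonal entry, the
  projection is injective on \<open>V\<close> and scales Lebesgue measure by the product of these entries
  (lemma \<open>diagonal_map_measure\<close>). Otherwise it kills a basis vector, so the image has smaller
  dimension and hence volume 0.

  The measure on a subspace is defined through one arbitrary orthonormal basis, so the
  computation in adapted bases needs its independence of the basis (lemma
  \<open>subspace_lebesgue_eq\<close>), that is, invariance of the product Lebesgue measure under rotations.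
  As the dimension is a variable here, determinants are avoided: a rotated copy of Lebesgue
  measure is translation invariant and agrees with it on the unit ball, and a
  Fubini argument shows that this determines it (lemma \<open>translation_invariant_eq_coord_lborel\<close>).
\<close>

section \<open>Lebesgue measure on coordinate space\<close>

text \<open>
  Borel-Lebesgue measure on the space of functions on \<open>{..<n}\<close>, extended by \<open>undefined\<close> outside.
\<close>

abbreviation coord_lborel :: "nat \<Rightarrow> (nat \<Rightarrow> real) measure"
  where "coord_lborel n \<equiv> \<Pi>\<^sub>M i\<in>{..<n}. (lborel :: real measure)"

lemma product_sigma_finite_lborel: "product_sigma_finite (\<lambda>i::nat. lborel :: real measure)"
  by standard

lemma sigma_finite_coord_lborel: "sigma_finite_measure (coord_lborel n)"
proof -
  interpret product_sigma_finite "\<lambda>i::nat. lborel :: real measure"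
    by (rule product_sigma_finite_lborel)
  show ?thesis by (rule sigma_finite) simp
qed

lemma emeasure_lborel_affine:
  fixes c t :: real
  assumes c: "c > 0" and A: "A \<in> sets borel"
  shows "ennreal c * emeasure lborel ((\<lambda>x. t + c * x) -` A) = emeasure lborel A"
proof -
  have "emeasure lborel A =
      emeasure (density (distr lborel borel (\<lambda>x. t + c * x)) (\<lambda>_. ennreal \<bar>c\<bar>)) A"
    using lborel_real_affine[of c t] c by simp
  also have "\<dots> = ennreal c * emeasure lborel ((\<lambda>x. t + c * x) -` A)"
    using c A by (simp add: emeasure_density nn_integral_cmult_indicator emeasure_distr)
  finally show ?thesis ..
qed

text \<open>
  The preimage form, with the scaling factor on the left, avoids division in \<open>ennreal\<close>.
\<close>

lemma emeasure_coordinatewise_affine: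
  fixes c t :: "nat \<Rightarrow> real"
  assumes c: "\<And>i. i < n \<Longrightarrow> c i > 0" and A: "A \<in> sets (coord_lborel n)"
  shows "ennreal (\<Prod>i<n. c i) *
    emeasure (coord_lborel n) ((\<lambda>x. \<lambda>i\<in>{..<n}. t i + c i * x i) -` A \<inter> space (coord_lborel n))
    = emeasure (coord_lborel n) A"
proof -
  interpret product_sigma_finite "\<lambda>i::nat. lborel :: real measure"
    by (rule product_sigma_finite_lborel)
  let ?M = "coord_lborel n"
  let ?T = "\<lambda>x. \<lambda>i\<in>{..<n}. t i + c i * x i"
  let ?k = "ennreal (\<Prod>i<n. c i)"
  have [measurable]: "?T \<in> measurable ?M ?M"
    by (intro measurable_restrict) measurable
  define P where "P = scale_measure ?k (distr ?M ?M ?T)"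
  have eP: "emeasure P A = ?k * emeasure ?M (?T -` A \<inter> space ?M)" if "A \<in> sets ?M" for A
    using that by (simp add: P_def emeasure_distr)
  have "P = ?M"
  proof (rule PiM_eqI)
    show "finite {..<n}" "sets P = sets ?M" by (auto simp: P_def)
    fix A :: "nat \<Rightarrow> real set" assume A: "\<And>i. i \<in> {..<n} \<Longrightarrow> A i \<in> sets lborel"
    have "?T -` Pi\<^sub>E {..<n} A \<inter> space ?M = (\<Pi>\<^sub>E i\<in>{..<n}. (\<lambda>x. t i + c i * x) -` A i)"
      by (auto simp: space_PiM PiE_iff)
    moreover have "(\<lambda>x. t i + c i * x) -` A i \<in> sets lborel" if "i < n" for i
      using measurable_sets_borel[of "\<lambda>x. t i + c i * x" borel "A i"] A that by simp
    moreover from this have "emeasure ?M (\<Pi>\<^sub>E i\<in>{..<n}. (\<lambda>x. t i + c i * x) -` A i) =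
        (\<Prod>i<n. emeasure lborel ((\<lambda>x. t i + c i * x) -` A i))"
      by (intro emeasure_PiM) auto
    moreover have "Pi\<^sub>E {..<n} A \<in> sets ?M"
      using A by (intro sets_PiM_I_finite) auto
    ultimately have "emeasure P (Pi\<^sub>E {..<n} A) =
        ?k * (\<Prod>i<n. emeasure lborel ((\<lambda>x. t i + c i * x) -` A i))"
      by (simp only: eP)
    also have "\<dots> = (\<Prod>i<n. ennreal (c i) * emeasure lborel ((\<lambda>x. t i + c i * x) -` A i))"
      using c by (subst prod_ennreal[symmetric]) (auto simp: prod.distrib less_imp_le)
    also have "\<dots> = (\<Prod>i<n. emeasure lborel (A i))"
      using c A by (intro prod.cong refl emeasure_lborel_affine) auto
    finally show "emeasure P (Pi\<^sub>E {..<n} A) = (\<Prod>i<n. emeasure lborel (A i))" .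
  qed
  then show ?thesis using eP[OF A] by simp
qed

lemma emeasure_coord_lborel_shift:
  assumes "A \<in> sets (coord_lborel n)"
  shows "emeasure (coord_lborel n) ((\<lambda>x. \<lambda>i\<in>{..<n}. x i + t i) -` A \<inter> space (coord_lborel n))
    = emeasure (coord_lborel n) A"
  using emeasure_coordinatewise_affine[of n "\<lambda>_. 1" A t, OF _ assms] by (simp add: add.commute)

text \<open>
  Uniqueness of Haar measure: Lebesgue measure \<open>M\<close> and \<open>\<nu>\<close> are translation invariant and
  \<open>\<sigma>\<close>-finite, so Fubini gives \<open>M A * \<nu> D = \<nu> A * M (- D)\<close> for all measurable \<open>A\<close> and \<open>D\<close>.
  A symmetric set \<open>D\<close> on which the two measures have the same finite nonzero value therefore
  makes them equal.
\<close>

lemma translation_invariant_eq_coord_lborel: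
  fixes \<nu> :: "(nat \<Rightarrow> real) measure" and n :: nat
  defines "M \<equiv> coord_lborel n"
  assumes sets_\<nu>: "sets \<nu> = sets M" and sf: "sigma_finite_measure \<nu>"
    and shift: "\<And>a B. a \<in> space M \<Longrightarrow> B \<in> sets M \<Longrightarrow>
      emeasure \<nu> ((\<lambda>x. \<lambda>i\<in>{..<n}. x i + a i) -` B \<inter> space M) = emeasure \<nu> B"
    and D: "D \<in> sets M"
    and D_sym: "\<And>x. x \<in> space M \<Longrightarrow> (\<lambda>i\<in>{..<n}. - x i) \<in> D \<longleftrightarrow> x \<in> D"
    and D_eq: "emeasure \<nu> D = emeasure M D"
    and D_pos: "emeasure M D \<noteq> 0" and D_fin: "emeasure M D \<noteq> \<infinity>"
  shows "\<nu> = M"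
proof (rule measure_eqI)
  show "sets \<nu> = sets M" by fact
  fix A assume "A \<in> sets \<nu>"
  then have A[measurable]: "A \<in> sets M" by (simp add: sets_\<nu>)
  note D[measurable]
  have sp: "space \<nu> = space M" by (rule sets_eq_imp_space_eq) fact
  have [measurable_cong]: "sets \<nu> = sets M" by fact
  interpret \<nu>: sigma_finite_measure \<nu> by fact
  interpret M: sigma_finite_measure M unfolding M_def by (rule sigma_finite_coord_lborel)
  interpret P: pair_sigma_finite M \<nu> ..
  let ?add = "\<lambda>x y. \<lambda>i\<in>{..<n}. x i + y i"
  let ?sub = "\<lambda>y x. \<lambda>i\<in>{..<n}. y i - x i"
  let ?neg = "\<lambda>x. \<lambda>i\<in>{..<n}. - x i"
  have cM: "f \<in> measurable N M \<longleftrightarrow> f \<in> measurable N (coord_lborel n)" for f and N :: "'c measure"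
    by (simp add: M_def)
  have [measurable]: "(\<lambda>x. x i) \<in> borel_measurable M" if "i \<in> {..<n}" for i
    using that unfolding M_def by measurable
  have add[measurable]: "(\<lambda>p. ?add (fst p) (snd p)) \<in> measurable (M \<Otimes>\<^sub>M \<nu>) M"
    "(\<lambda>p. ?add (snd p) (fst p)) \<in> measurable (M \<Otimes>\<^sub>M \<nu>) M"
    "(\<lambda>p. ?sub (snd p) (fst p)) \<in> measurable (M \<Otimes>\<^sub>M \<nu>) M"
    unfolding cM by (intro measurable_restrict; measurable)+
  have [measurable]: "?neg \<in> measurable M M"
    unfolding cM by (intro measurable_restrict; measurable)
  have closed: "?add x y \<in> space M" "?sub x y \<in> space M" "?neg x \<in> space M" for x y
    by (auto simp: M_def space_PiM)
  have "emeasure M A * emeasure \<nu> D = (\<integral>\<^sup>+x. indicator A x * emeasure \<nu> D \<partial>M)"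
    by (simp add: nn_integral_multc)
  \<comment> \<open>Translate the inner \<open>\<nu>\<close>-measure of \<open>D\<close> by \<open>x\<close>.\<close>
  also have "\<dots> = (\<integral>\<^sup>+x. (\<integral>\<^sup>+y. indicator A x * indicator D (?sub y x) \<partial>\<nu>) \<partial>M)"
  proof (rule nn_integral_cong)
    fix x assume x: "x \<in> space M"
    have "emeasure \<nu> D = emeasure \<nu> ((\<lambda>y. ?sub y x) -` D \<inter> space M)"
      using shift[OF closed(3)[of x] D] by (simp add: restrict_def cong: if_cong)
    also have "\<dots> = (\<integral>\<^sup>+y. indicator D (?sub y x) \<partial>\<nu>)"
    proof -
      have "(\<lambda>y. ?sub y x) -` D \<inter> space M \<in> sets \<nu>"
        unfolding sets_\<nu> by (rule measurable_sets[OF _ D], unfold cM, intro measurable_restrict) measurable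
      from nn_integral_indicator[OF this, symmetric] show ?thesis
        by (rule trans) (auto intro!: nn_integral_cong simp: indicator_def sp)
    qed
    finally show "indicator A x * emeasure \<nu> D =
        (\<integral>\<^sup>+y. indicator A x * indicator D (?sub y x) \<partial>\<nu>)"
      by (cases "x \<in> A") auto
  qed
  also have "\<dots> = (\<integral>\<^sup>+y. (\<integral>\<^sup>+x. indicator A x * indicator D (?sub y x) \<partial>M) \<partial>\<nu>)"
    by (rule P.Fubini'[symmetric]) (simp add: split_beta', measurable)
  \<comment> \<open>Substitute \<open>x + y\<close> for \<open>x\<close> in the inner integral.\<close>
  also have "\<dots> = (\<integral>\<^sup>+y. (\<integral>\<^sup>+x. indicator A (?add x y) * indicator D (?neg x) \<partial>M) \<partial>\<nu>)"
  proof (rule nn_integral_cong)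
    fix y assume y: "y \<in> space \<nu>"
    have T[measurable]: "(\<lambda>x. ?add x y) \<in> measurable M M" "(\<lambda>x. ?sub y x) \<in> measurable M M"
      unfolding cM by (intro measurable_restrict; measurable)+
    have *: "distr M M (\<lambda>x. ?add x y) = M"
    proof (rule measure_eqI)
      fix B assume "B \<in> sets (distr M M (\<lambda>x. ?add x y))"
      then show "emeasure (distr M M (\<lambda>x. ?add x y)) B = emeasure M B"
        using T emeasure_coord_lborel_shift[of B n y] by (simp add: emeasure_distr M_def)
    qed simp
    have "(\<integral>\<^sup>+x. indicator A x * indicator D (?sub y x) \<partial>M) =
        (\<integral>\<^sup>+x. indicator A x * indicator D (?sub y x) \<partial>distr M M (\<lambda>x. ?add x y))"
      by (simp add: *)
    also have "\<dots> = (\<integral>\<^sup>+x. indicator A (?add x y) * indicator D (?sub y (?add x y)) \<partial>M)"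
      by (rule nn_integral_distr) measurable
    also have "\<dots> = (\<integral>\<^sup>+x. indicator A (?add x y) * indicator D (?neg x) \<partial>M)"
      by (intro nn_integral_cong arg_cong2[where f="(*)"] refl arg_cong[where f="indicator D"]) auto
    finally show "(\<integral>\<^sup>+x. indicator A x * indicator D (?sub y x) \<partial>M) =
      (\<integral>\<^sup>+x. indicator A (?add x y) * indicator D (?neg x) \<partial>M)" .
  qed
  also have "\<dots> = (\<integral>\<^sup>+x. (\<integral>\<^sup>+y. indicator A (?add x y) * indicator D (?neg x) \<partial>\<nu>) \<partial>M)"
    by (rule P.Fubini') (simp add: split_beta', measurable)
  also have "\<dots> = (\<integral>\<^sup>+x. emeasure \<nu> A * indicator D x \<partial>M)"
  proof (rule nn_integral_cong)
    fix x assume x: "x \<in> space M"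
    have "emeasure \<nu> A = emeasure \<nu> ((\<lambda>y. ?add x y) -` A \<inter> space M)"
      using shift[OF x A] by (simp add: add.commute)
    also have "\<dots> = (\<integral>\<^sup>+y. indicator A (?add x y) \<partial>\<nu>)"
    proof -
      have "(\<lambda>y. ?add x y) -` A \<inter> space M \<in> sets \<nu>"
        unfolding sets_\<nu> by (rule measurable_sets[OF _ A], unfold cM, intro measurable_restrict) measurable
      from nn_integral_indicator[OF this, symmetric] show ?thesis
        by (rule trans) (auto intro!: nn_integral_cong simp: indicator_def sp)
    qed
    finally show "(\<integral>\<^sup>+y. indicator A (?add x y) * indicator D (?neg x) \<partial>\<nu>) =
        emeasure \<nu> A * indicator D x"
      using D_sym[OF x] by (auto simp: indicator_def)
  qed
  also have "\<dots> = emeasure \<nu> A * emeasure M D"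
    by (simp add: nn_integral_cmult)
  finally have "emeasure M D * emeasure M A = emeasure M D * emeasure \<nu> A"
    by (simp add: D_eq mult.commute)
  then show "emeasure \<nu> A = emeasure M A"
    using D_pos D_fin by (simp add: ennreal_mult_cancel_left)
qed

section \<open>Inner product spaces over the real or complex numbers\<close>

text \<open>
  A real inner product space whose scalars extend to a field \<open>'k\<close>, with a Hermitian \<open>'k\<close>-valued
  product \<open>ip\<close> that is linear in the first argument. The functions \<open>re\<close> and \<open>conj\<close> are the real
  part and the conjugation of \<open>'k\<close>, and \<open>units\<close> is a basis of \<open>'k\<close> over the reals that is
  orthonormal for \<open>re (z * conj w)\<close>.
\<close>

locale scalar_inner_space = vector_space smul
  for smul :: "'k::real_normed_field \<Rightarrow> 'a::real_inner \<Rightarrow> 'a" +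
  fixes ip :: "'a \<Rightarrow> 'a \<Rightarrow> 'k" and re :: "'k \<Rightarrow> real" and conj :: "'k \<Rightarrow> 'k" and units :: "'k list"
  assumes smul_of_real: "smul (of_real r) x = r *\<^sub>R x"
    and ip_commute: "ip y x = conj (ip x y)"
    and ip_add_left: "ip (x + y) z = ip x z + ip y z"
    and ip_smul_left: "ip (smul c x) y = c * ip x y"
    and inner_eq_re: "x \<bullet> y = re (ip x y)"
    and conj_add: "conj (c + d) = conj c + conj d"
    and conj_mult: "conj (c * d) = conj c * conj d"
    and conj_of_real: "conj (of_real r) = of_real r"
    and conj_eq_self: "conj c = c \<Longrightarrow> c = of_real (re c)"
    and re_of_real: "re (of_real r) = r"
    and units_orthonormal: "i < length units \<Longrightarrow> j < length units \<Longrightarrow>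
      re (units ! i * conj (units ! j)) = (if i = j then 1 else 0)"
    and units_expansion: "c = (\<Sum>i<length units. of_real (re (c * conj (units ! i))) * units ! i)"
begin

text \<open>Orthonormal bases over the scalar field \<open>'k\<close>.\<close>

abbreviation onb :: "'a set \<Rightarrow> 'a list \<Rightarrow> bool" where "onb \<equiv> orthonormal_basis smul ip"

lemma ip_0_left [simp]: "ip 0 y = 0"
  using ip_add_left[of 0 0 y] by simp

lemma conj_0: "conj 0 = 0" and re_0: "re 0 = 0"
  using conj_of_real[of 0] re_of_real[of 0] by simp_all

lemma ip_add_right: "ip x (y + z) = ip x y + ip x z"
  by (subst (1 2 3) ip_commute) (simp add: ip_add_left conj_add)

lemma ip_smul_right: "ip x (smul c y) = conj c * ip x y"
  by (subst (1 2) ip_commute) (simp add: ip_smul_left conj_mult)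

lemma ip_0_right [simp]: "ip x 0 = 0"
  by (subst ip_commute) (simp add: conj_0)

lemma ip_eq_0_commute: "ip x y = 0 \<longleftrightarrow> ip y x = 0"
  by (metis ip_commute conj_0)

lemma ip_diff_left: "ip (x - y) z = ip x z - ip y z"
  using ip_add_left[of "x - y" y z] by (simp add: algebra_simps)

lemma ip_sum_left: "ip (\<Sum>i\<in>I. f i) y = (\<Sum>i\<in>I. ip (f i) y)"
  by (induction I rule: infinite_finite_induct) (simp_all add: ip_add_left)

lemma ip_self: "ip x x = of_real (x \<bullet> x)"
  using conj_eq_self[of "ip x x"] ip_commute[of x x] by (simp add: inner_eq_re)

lemma ip_self_eq_0: "ip x x = 0 \<longleftrightarrow> x = 0"
  by (simp add: ip_self)

lemma subspace_imp_real_subspace: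
  assumes "subspace V" shows "Real_Vector_Spaces.subspace V"
  unfolding Real_Vector_Spaces.subspace_def
  using assms by (auto simp: subspace_0 subspace_add smul_of_real[symmetric] subspace_scale)

section \<open>Orthonormal lists\<close>

text \<open>Orthonormality of a list in the product \<open>ip\<close>.\<close>

definition orthonormal :: "'a list \<Rightarrow> bool"
  where "orthonormal e \<longleftrightarrow>
    (\<forall>i<length e. \<forall>j<length e. ip (e ! i) (e ! j) = (if i = j then 1 else 0))"

text \<open>
  The orthogonal projection onto the span of an orthonormal list, by its expansion in the list.
\<close>

definition proj :: "'a list \<Rightarrow> 'a \<Rightarrow> 'a"
  where "proj e x = (\<Sum>i<length e. smul (ip x (e ! i)) (e ! i))"

lemma onb_iff: "onb U e \<longleftrightarrow> orthonormal e \<and> span (set e) = U"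
  by (simp add: orthonormal_basis_def orthonormal_def)

lemma orthonormal_Cons:
  "orthonormal (u # e) \<longleftrightarrow> ip u u = 1 \<and> (\<forall>v\<in>set e. ip u v = 0) \<and> orthonormal e"
proof -
  have "(\<forall>j<length e. ip u (e ! j) = 0) \<and> (\<forall>i<length e. ip (e ! i) u = 0) \<longleftrightarrow> (\<forall>v\<in>set e. ip u v = 0)"
    by (auto simp: all_set_conv_all_nth ip_eq_0_commute[of _ u])
  then show ?thesis
    by (auto simp: orthonormal_def All_less_Suc2)
qed

lemma proj_in_span: "proj e x \<in> span (set e)"
  unfolding proj_def by (intro span_sum span_scale span_base) auto

lemma ip_proj:
  assumes "orthonormal e" "j < length e"
  shows "ip (proj e x) (e ! j) = ip x (e ! j)"
proof -
  have "ip (proj e x) (e ! j) = (\<Sum>i<length e. ip x (e ! i) * (if i = j then 1 else 0))"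
    using assms by (auto simp: proj_def ip_sum_left ip_smul_left orthonormal_def intro!: sum.cong)
  also have "\<dots> = ip x (e ! j)"
    using assms by (simp add: if_distrib cong: if_cong)
  finally show ?thesis .
qed

lemma ip_span_eq_0:
  assumes "w \<in> span (set e)" and "\<And>v. v \<in> set e \<Longrightarrow> ip x v = 0"
  shows "ip x w = 0"
proof (rule span_induct[OF assms(1)])
  show "ip x v = 0" if "v \<in> set e" for v by (rule assms(2)[OF that])
  show "subspace {w. ip x w = 0}"
    by (auto simp: subspace_def ip_add_right ip_smul_right)
qed

lemma ip_diff_proj:
  assumes "orthonormal e" "w \<in> span (set e)"
  shows "ip (x - proj e x) w = 0"
  by (rule ip_span_eq_0[OF assms(2)]) (use assms(1) in \<open>auto simp: in_set_conv_nth ip_diff_left ip_proj\<close>)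

lemma proj_eq_self:
  assumes "orthonormal e" "x \<in> span (set e)"
  shows "proj e x = x"
proof -
  have "x - proj e x \<in> span (set e)"
    using assms(2) proj_in_span by (rule span_diff)
  from ip_diff_proj[OF assms(1) this, of x] show ?thesis
    by (simp add: ip_self_eq_0)
qed

lemma orthogonal_projection_eqI:
  assumes W: "subspace W" and y: "y \<in> W" and orth: "\<And>w. w \<in> W \<Longrightarrow> ip (x - y) w = 0"
  shows "orthogonal_projection ip W x = y"
  unfolding orthogonal_projection_def
proof (rule the_equality)
  fix z assume z: "z \<in> W \<and> (\<forall>w\<in>W. ip (x - z) w = 0)"
  have "z - y \<in> W" using W z y by (simp add: subspace_diff)
  then have "ip (x - y) (z - y) - ip (x - z) (z - y) = 0" using z orth by simp
  then have "ip (z - y) (z - y) = 0" by (simp flip: ip_diff_left)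
  then show "z = y" by (simp add: ip_self_eq_0)
qed (use y orth in auto)

lemma orthogonal_projection_eq_proj:
  assumes "onb W e"
  shows "orthogonal_projection ip W = proj e"
proof
  fix x show "orthogonal_projection ip W x = proj e x"
    using assms by (intro orthogonal_projection_eqI)
      (auto simp: onb_iff proj_in_span ip_diff_proj subspace_span)
qed

lemma orthonormal_distinct: "orthonormal e \<Longrightarrow> distinct e"
  unfolding distinct_conv_nth orthonormal_def by (metis zero_neq_one)

lemma orthonormal_independent:
  assumes "orthonormal e"
  shows "independent (set e)"
proof
  assume "dependent (set e)"
  then obtain u v where v: "v \<in> set e" "u v \<noteq> 0" and 0: "(\<Sum>w\<in>set e. smul (u w) w) = 0"
    by (auto simp: dependent_finite)
  have "ip w v = (if w = v then 1 else 0)" if "w \<in> set e" for w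
    using assms that v(1) by (auto simp: orthonormal_def in_set_conv_nth)
  then have "ip (\<Sum>w\<in>set e. smul (u w) w) v = (\<Sum>w\<in>set e. u w * (if w = v then 1 else 0))"
    by (auto simp: ip_sum_left ip_smul_left intro!: sum.cong)
  also have "\<dots> = u v" using v(1) by (simp add: if_distrib cong: if_cong)
  finally show False using 0 v(2) by simp
qed

lemma onb_zero_iff:
  assumes "onb U u" shows "U = {0} \<longleftrightarrow> u = []"
proof
  assume "u = []" then show "U = {0}" using assms by (auto simp: onb_iff)
next
  assume U: "U = {0}"
  show "u = []"
  proof (cases u)
    case (Cons a l)
    then have "a \<in> U" using assms span_base[of a "set u"] by (auto simp: onb_iff)
    then show ?thesis using assms Cons U by (simp add: onb_iff orthonormal_Cons)
  qed simp
qed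

lemma onb_dim: "onb U e \<Longrightarrow> dim U = length e"
  using orthonormal_independent orthonormal_distinct
  by (metis onb_iff dim_span_eq_card_independent distinct_card)

lemma onb_subspace: "onb U e \<Longrightarrow> subspace U"
  by (auto simp: onb_iff subspace_span)

lemma onb_mem: "onb U e \<Longrightarrow> x \<in> set e \<Longrightarrow> x \<in> U"
  by (auto simp: onb_iff span_base)

text \<open>A longest orthonormal list in \<open>U\<close> spans \<open>U\<close>, by one step of the Gram--Schmidt process.\<close>

lemma exists_onb:
  assumes fin: "\<exists>B. finite B \<and> span B = UNIV" and U: "subspace U"
  obtains e where "onb U e"
proof -
  obtain B where B: "finite B" "span B = UNIV" using fin by blast
  let ?P = "\<lambda>e. orthonormal e \<and> set e \<subseteq> U"
  have bound: "length e \<le> card B" if "?P e" for e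
    using independent_span_bound[of B "set e"] B that
    by (auto simp: orthonormal_independent distinct_card orthonormal_distinct)
  have "\<exists>e. ?P e \<and> (\<forall>e'. ?P e' \<longrightarrow> length e' \<le> length e)"
    by (rule ex_has_greatest_nat[of ?P "[]" length "Suc (card B)"])
      (use bound in \<open>auto simp: orthonormal_def less_Suc_eq_le\<close>)
  then obtain e where e: "?P e" and max: "\<And>e'. ?P e' \<Longrightarrow> length e' \<le> length e" by blast
  have span: "span (set e) \<subseteq> U" using e U by (simp add: span_minimal)
  moreover have "U \<subseteq> span (set e)"
  proof (rule ccontr)
    assume "\<not> U \<subseteq> span (set e)"
    then obtain x where x: "x \<in> U" "x \<notin> span (set e)" by blast
    define d where "d = x - proj e x"
    define u where "u = (1 / norm d) *\<^sub>R d"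
    have "d \<noteq> 0" using x(2) proj_in_span[of e x] by (auto simp: d_def)
    then have "u \<bullet> u = 1" by (simp add: u_def dot_square_norm)
    moreover have "d \<in> U" using U x(1) span proj_in_span[of e x] by (auto simp: d_def subspace_diff)
    moreover have "ip d v = 0" if "v \<in> set e" for v
      unfolding d_def using e that by (auto intro: ip_diff_proj span_base)
    ultimately have "?P (u # e)" using e U
      by (simp add: orthonormal_Cons ip_self) (simp add: u_def ip_smul_left subspace_scale flip: smul_of_real)
    then show False using max by fastforce
  qed
  ultimately show ?thesis using e that by (auto simp: onb_iff)
qed

section \<open>Restriction of scalars to the reals\<close>

text \<open>
  All products \<open>u e\<close> of a scalar \<open>u\<close> from \<open>units\<close> with a vector \<open>e\<close> of the list. The scalar varies
  fastest, so with \<open>m = length units\<close> the entry \<open>k\<close> comes from the vector with index \<open>k div m\<close>.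
\<close>

definition realify :: "'a list \<Rightarrow> 'a list"
  where "realify e = map (\<lambda>k. smul (units ! (k mod length units)) (e ! (k div length units)))
    [0..<length e * length units]"

lemma length_realify [simp]: "length (realify e) = length e * length units"
  by (simp add: realify_def)

lemma realify_nth: "k < length e * length units \<Longrightarrow>
    realify e ! k = smul (units ! (k mod length units)) (e ! (k div length units))"
  by (simp add: realify_def)

lemma length_units_pos: "length units > 0"
  using units_expansion[of 1] by auto

lemma smul_unit_in_realify:
  assumes "a < length e" "i < length units"
  shows "smul (units ! i) (e ! a) \<in> set (realify e)"
proof -
  have k: "a * length units + i < length e * length units"
    using assms mult_le_mono1[of "Suc a" "length e" "length units"] by simp
  have "realify e ! (a * length units + i) = smul (units ! i) (e ! a)"
    using assms length_units_pos by (simp add: realify_nth[OF k])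
  then show ?thesis using k by (metis length_realify nth_mem)
qed

lemma onb_realify:
  assumes V: "onb V e"
  shows "orthonormal_basis (*\<^sub>R) (\<bullet>) V (realify e)"
proof -
  let ?m = "length units"
  have m: "0 < ?m" by (rule length_units_pos)
  have "(realify e ! k) \<bullet> (realify e ! l) = (if k = l then 1 else 0)"
    if k: "k < length e * ?m" and l: "l < length e * ?m" for k l
  proof -
    have a: "k div ?m < length e" "l div ?m < length e" "k mod ?m < ?m" "l mod ?m < ?m"
      using k l m by (auto simp: less_mult_imp_div_less)
    have "k = l \<longleftrightarrow> k div ?m = l div ?m \<and> k mod ?m = l mod ?m"
      by (metis div_mult_mod_eq)
    then show ?thesis
      using V a units_orthonormal[OF a(3,4)]
      by (auto simp: realify_nth k l inner_eq_re ip_smul_left ip_smul_right onb_iff orthonormal_def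
          mult.commute[of "conj _"] re_0)
  qed
  moreover have "Real_Vector_Spaces.span (set (realify e)) = V"
  proof
    have "set (realify e) \<subseteq> V"
    proof
      fix x assume "x \<in> set (realify e)"
      then obtain k where k: "k < length e * ?m" "x = realify e ! k"
        by (auto simp: in_set_conv_nth)
      then have "e ! (k div ?m) \<in> V"
        by (intro onb_mem[OF V] nth_mem) (simp add: less_mult_imp_div_less)
      then show "x \<in> V"
        using k by (simp add: realify_nth subspace_scale[OF onb_subspace[OF V]])
    qed
    then show "Real_Vector_Spaces.span (set (realify e)) \<subseteq> V"
      by (rule real_vector.span_minimal)
        (rule subspace_imp_real_subspace[OF onb_subspace[OF V]])
    show "V \<subseteq> Real_Vector_Spaces.span (set (realify e))"
    proof
      fix x assume "x \<in> V"
      then have "x = (\<Sum>a<length e. smul (ip x (e ! a)) (e ! a))"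
        using V proj_eq_self[of e x] by (simp add: onb_iff proj_def)
      also have "\<dots> = (\<Sum>a<length e. \<Sum>i<?m. re (ip x (e ! a) * conj (units ! i)) *\<^sub>R smul (units ! i) (e ! a))"
      proof (rule sum.cong[OF refl])
        fix a
        show "smul (ip x (e ! a)) (e ! a) =
          (\<Sum>i<?m. re (ip x (e ! a) * conj (units ! i)) *\<^sub>R smul (units ! i) (e ! a))"
          by (subst units_expansion[of "ip x (e ! a)"])
            (simp add: scale_sum_left smul_of_real flip: scale_scale)
      qed
      also have "\<dots> \<in> Real_Vector_Spaces.span (set (realify e))"
        by (intro real_vector.span_sum real_vector.span_scale real_vector.span_base smul_unit_in_realify) auto
      finally show "x \<in> Real_Vector_Spaces.span (set (realify e))" .
    qed
  qed
  ultimately show ?thesis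
    by (simp add: orthonormal_basis_def span_raw_def)
qed

end

interpretation real_ip: scalar_inner_space "(*\<^sub>R)" "(\<bullet>)" "\<lambda>x. x" "\<lambda>x. x" "[1]"
  by standard (simp_all add: inner_commute algebra_simps)

section \<open>Singular value decomposition of a projection\<close>

text \<open>
  The span of a list contains a compact set with all combinations of coefficients in \<open>[-1, 1]\<close>.
  It gives compactness of the unit sphere of a finite-dimensional subspace, although the ambient
  type is not of class \<open>heine_borel\<close>.
\<close>

lemma compact_contains_box:
  fixes b :: "'a::real_normed_vector list"
  shows "\<exists>K. compact K \<and> K \<subseteq> span (set b) \<and>
    (\<forall>t. (\<forall>i<length b. \<bar>t i\<bar> \<le> 1) \<longrightarrow> (\<Sum>i<length b. t i *\<^sub>R b ! i) \<in> K)"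
proof (induction b)
  case Nil
  show ?case by (rule exI[of _ "{0}"]) simp
next
  case (Cons a b)
  then obtain K where K: "compact K" "K \<subseteq> span (set b)"
    "\<And>t. (\<forall>i<length b. \<bar>t i\<bar> \<le> 1) \<Longrightarrow> (\<Sum>i<length b. t i *\<^sub>R b ! i) \<in> K"
    by blast
  let ?h = "\<lambda>(s::real, x). s *\<^sub>R a + x"
  have "compact (?h ` ({-1..1} \<times> K))"
    by (intro compact_continuous_image compact_Times K compact_Icc)
      (simp add: split_beta', intro continuous_intros)
  moreover have "?h ` ({-1..1} \<times> K) \<subseteq> span (set (a # b))"
  proof clarsimp
    fix t :: real and x assume "x \<in> K"
    then have "x \<in> span (insert a (set b))"
      using K(2) span_mono[of "set b" "insert a (set b)"] by blast
    then show "t *\<^sub>R a + x \<in> span (insert a (set b))"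
      by (intro span_add span_scale[OF span_base]) simp_all
  qed
  moreover have "(\<Sum>i<length (a # b). t i *\<^sub>R (a # b) ! i) \<in> ?h ` ({-1..1} \<times> K)"
    if "\<forall>i<length (a # b). \<bar>t i\<bar> \<le> 1" for t
  proof -
    have "(\<Sum>i<length b. t (Suc i) *\<^sub>R b ! i) \<in> K"
      using that by (intro K(3)) auto
    moreover have "\<bar>t 0\<bar> \<le> 1" using that by auto
    then have "t 0 \<in> {-1..1}" by (simp add: abs_le_iff)
    ultimately have "?h (t 0, \<Sum>i<length b. t (Suc i) *\<^sub>R b ! i) \<in> ?h ` ({-1..1} \<times> K)"
      by blast
    then show ?thesis
      by (simp add: sum.lessThan_Suc_shift del: sum.lessThan_Suc)
  qed
  ultimately show ?case
    by (intro exI[of _ "?h ` ({-1..1} \<times> K)"] conjI allI impI)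
qed

lemma compact_unit_sphere_subspace:
  assumes "orthonormal_basis (*\<^sub>R) (\<bullet>) V b"
  shows "compact {x\<in>V. norm x = 1}"
proof -
  have b: "real_ip.orthonormal b" "span (set b) = V"
    using assms by (auto simp: real_ip.onb_iff span_raw_def)
  obtain K where K: "compact K" "K \<subseteq> V"
    "\<And>t. (\<forall>i<length b. \<bar>t i\<bar> \<le> 1) \<Longrightarrow> (\<Sum>i<length b. t i *\<^sub>R b ! i) \<in> K"
    using compact_contains_box[of b] b by blast
  have "x \<in> K" if x: "x \<in> V" "norm x = 1" for x
  proof -
    have "norm (b ! i) = 1" if "i < length b" for i
      using b(1) that by (simp add: real_ip.orthonormal_def norm_eq_1)
    then have "\<bar>x \<bullet> b ! i\<bar> \<le> 1" if "i < length b" for i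
      using Cauchy_Schwarz_ineq2[of x "b ! i"] that x by simp
    moreover have "(\<Sum>i<length b. (x \<bullet> b ! i) *\<^sub>R b ! i) = x"
      using real_ip.proj_eq_self[OF b(1), of x] b(2) x by (simp add: real_ip.proj_def span_raw_def)
    ultimately show ?thesis using K(3)[of "\<lambda>i. x \<bullet> b ! i"] by simp
  qed
  then have "{x\<in>V. norm x = 1} = K \<inter> {x. norm x = 1}"
    using K(2) by auto
  moreover have "closed {x::'a. norm x = 1}"
    by (intro closed_Collect_eq continuous_intros)
  ultimately show ?thesis using K(1) by (simp add: compact_Int_closed)
qed

text \<open>
  If \<open>e\<close> maximises the inner product with \<open>f\<close> among the unit vectors of \<open>V\<close>, then \<open>f\<close> is orthogonal
  to the real orthogonal complement of \<open>e\<close> in \<open>V\<close>. Otherwise, with \<open>s = e \<bullet> f\<close> and a unit vector \<open>y\<close>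
  of that complement with \<open>r = y \<bullet> f\<close> nonzero, the normalisation of \<open>s e + r y\<close> would have inner
  product \<open>sqrt (s\<^sup>2 + r\<^sup>2) > s\<close> with \<open>f\<close>.
\<close>

lemma extremal_vector_orthogonal:
  fixes V :: "'a::real_inner set"
  assumes V: "subspace V" and e: "e \<in> V" "norm e = 1"
    and max: "\<And>u. u \<in> V \<Longrightarrow> norm u = 1 \<Longrightarrow> u \<bullet> f \<le> e \<bullet> f" and pos: "0 \<le> e \<bullet> f"
    and x: "x \<in> V" "x \<bullet> e = 0"
  shows "x \<bullet> f = 0"
proof (rule ccontr)
  assume nz: "x \<bullet> f \<noteq> 0"
  define s y where "s = e \<bullet> f" and "y = (1 / norm x) *\<^sub>R x"
  define r where "r = y \<bullet> f"
  define u where "u = s *\<^sub>R e + r *\<^sub>R y"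
  define N where "N = sqrt (s\<^sup>2 + r\<^sup>2)"
  have "x \<noteq> 0" using nz by auto
  then have r: "r \<noteq> 0" and y: "y \<in> V" "y \<bullet> y = 1" "y \<bullet> e = 0"
    using nz V x by (auto simp: r_def y_def subspace_scale dot_square_norm)
  have "e \<bullet> e = 1" using e(2) by (simp add: dot_square_norm)
  then have u: "u \<in> V" "u \<bullet> u = s\<^sup>2 + r\<^sup>2" "u \<bullet> f = s\<^sup>2 + r\<^sup>2"
    using V e y by (auto simp: u_def subspace_add subspace_scale algebra_simps power2_eq_square
      inner_commute[of e y] s_def r_def)
  have "N > 0" using r by (auto simp: N_def intro: add_nonneg_pos)
  have N2: "s\<^sup>2 + r\<^sup>2 = N * N" by (simp add: N_def)
  have "norm u = N" by (simp add: norm_eq_sqrt_inner u N_def)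
  then have "((1 / N) *\<^sub>R u) \<bullet> f \<le> s"
    unfolding s_def using V u(1) \<open>N > 0\<close> by (intro max) (auto simp: subspace_scale)
  then have "N \<le> s" using \<open>N > 0\<close> by (simp add: u(3) N2)
  then have "N * N \<le> s\<^sup>2" using \<open>N > 0\<close> by (simp add: power2_eq_square mult_mono)
  then show False using r by (simp flip: N2)
qed

context scalar_inner_space
begin

lemma unit_vector_re:
  assumes "norm x = 1" shows "(smul c x) \<bullet> x = re c"
  using ip_self[of x] assms
  by (simp add: inner_eq_re[of "smul c x"] ip_smul_left dot_square_norm)

lemma eq_0_if_re_mult_eq_0:
  assumes "\<And>c. re (z * conj c) = 0" shows "z = 0"
  using units_expansion[of z, unfolded assms] by simp

text \<open>
  Over \<open>'k\<close>, the same maximality yields orthogonality in \<open>ip\<close>, and it makes \<open>ip e f\<close> real because a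
  multiple \<open>c e\<close> with \<open>re c = 0\<close> is orthogonal to \<open>e\<close> in the real sense.
\<close>

lemma extremal_pair:
  assumes V: "subspace V" and e: "e \<in> V" "norm e = 1"
    and max: "\<And>u. u \<in> V \<Longrightarrow> norm u = 1 \<Longrightarrow> u \<bullet> f \<le> e \<bullet> f" and pos: "0 \<le> e \<bullet> f"
  shows "\<And>x. x \<in> V \<Longrightarrow> ip x e = 0 \<Longrightarrow> ip x f = 0"
    and "ip e f = of_real (e \<bullet> f)"
proof -
  have orth: "x \<bullet> f = 0" if "x \<in> V" "x \<bullet> e = 0" for x
    using extremal_vector_orthogonal[OF subspace_imp_real_subspace[OF V] e _ pos that] max by blast
  show "ip x f = 0" if x: "x \<in> V" "ip x e = 0" for x
  proof (rule eq_0_if_re_mult_eq_0)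
    fix c
    have "smul (conj c) x \<bullet> f = 0"
      using x V by (intro orth) (auto simp: subspace_scale inner_eq_re ip_smul_left re_0)
    then show "re (ip x f * conj c) = 0" by (simp add: inner_eq_re ip_smul_left mult.commute)
  qed
  have re: "re (ip e f * c) = e \<bullet> f * re c" for c
  proof -
    have "smul c e - re c *\<^sub>R e \<in> V"
      using V e(1) by (simp only: smul_of_real[symmetric] subspace_diff subspace_scale)
    moreover have "(smul c e - re c *\<^sub>R e) \<bullet> e = 0"
      using e(2) by (simp add: inner_diff_left unit_vector_re dot_square_norm)
    ultimately have "(smul c e - re c *\<^sub>R e) \<bullet> f = 0"
      by (rule orth)
    then have "smul c e \<bullet> f = re c * (e \<bullet> f)"
      by (simp add: inner_diff_left)
    then show ?thesis
      by (simp add: inner_eq_re[of "smul c e"] ip_smul_left mult.commute)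
  qed
  have "ip e f = (\<Sum>i<length units. of_real (e \<bullet> f * re (conj (units ! i))) * units ! i)"
    by (rule units_expansion[of "ip e f", unfolded re])
  also have "\<dots> = of_real (e \<bullet> f) * (\<Sum>i<length units. of_real (re (1 * conj (units ! i))) * units ! i)"
    by (simp add: sum_distrib_left mult.assoc)
  finally show "ip e f = of_real (e \<bullet> f)"
    unfolding units_expansion[of 1, symmetric] by simp
qed

lemma exists_extremal_pair:
  assumes V: "onb V v" and W: "onb W w" and nz: "V \<noteq> {0}" "W \<noteq> {0}"
  obtains e f where "e \<in> V" "f \<in> W" "norm e = 1" "norm f = 1" "0 \<le> e \<bullet> f"
    "\<And>x y. x \<in> V \<Longrightarrow> y \<in> W \<Longrightarrow> norm x = 1 \<Longrightarrow> norm y = 1 \<Longrightarrow> x \<bullet> y \<le> e \<bullet> f"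
proof -
  define S where "S = (\<lambda>U::'a set. {x\<in>U. norm x = 1})"
  have ne: "S U \<noteq> {}" if U: "subspace U" "U \<noteq> {0}" for U
  proof -
    obtain x where "x \<in> U" "x \<noteq> 0" using U(2) subspace_0[OF U(1)] by auto
    then have "(1 / norm x) *\<^sub>R x \<in> S U"
      using subspace_scale[OF U(1), of x "of_real (1 / norm x)"] by (simp only: smul_of_real) (simp add: S_def)
    then show ?thesis by blast
  qed
  have "compact (S V \<times> S W)"
    unfolding S_def by (intro compact_Times compact_unit_sphere_subspace) (rule onb_realify V W)+
  moreover have "S V \<times> S W \<noteq> {}"
    using ne[OF onb_subspace] V W nz by blast
  moreover have "continuous_on (S V \<times> S W) (\<lambda>(x, y). x \<bullet> y)"
    by (auto simp: split_beta' intro!: continuous_intros)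
  ultimately obtain p where p: "p \<in> S V \<times> S W"
    and max: "\<And>q. q \<in> S V \<times> S W \<Longrightarrow> (case q of (x, y) \<Rightarrow> x \<bullet> y) \<le> (case p of (x, y) \<Rightarrow> x \<bullet> y)"
    using continuous_attains_sup[of "S V \<times> S W" "\<lambda>(x, y). x \<bullet> y"] by blast
  obtain e f where [simp]: "p = (e, f)" by (cases p)
  have max': "x \<bullet> y \<le> e \<bullet> f" if "x \<in> V" "y \<in> W" "norm x = 1" "norm y = 1" for x y
    using max[of "(x, y)"] that by (simp add: S_def)
  have "0 \<le> e \<bullet> f"
    using max'[of "- e" f] p onb_subspace[OF V] by (auto simp: S_def subspace_neg)
  with that[of e f] max' p show ?thesis by (auto simp: S_def)
qed

lemma norm_onb_nth:
  assumes "onb U u" "i < length u" shows "norm (u ! i) = 1"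
proof -
  have "ip (u ! i) (u ! i) = 1" using assms by (simp add: onb_iff orthonormal_def)
  then have "u ! i \<bullet> u ! i = 1" by (metis ip_self of_real_eq_1_iff)
  then show ?thesis by (simp add: norm_eq_1)
qed

lemma onb_Cons_complement:
  assumes V: "subspace V" and e: "e \<in> V" "norm e = 1"
    and e': "onb {x\<in>V. ip x e = 0} e'"
  shows "onb V (e # e')"
proof -
  have ee: "ip e e = 1" using e by (simp add: ip_self dot_square_norm)
  have "orthonormal (e # e')"
    using e' onb_mem[OF e'] ee by (auto simp: orthonormal_Cons onb_iff ip_eq_0_commute[of e])
  moreover have "span (set (e # e')) \<subseteq> V"
    using onb_mem[OF e'] e V by (intro span_minimal) auto
  moreover have "x \<in> span (set (e # e'))" if "x \<in> V" for x
  proof -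
    have "x - smul (ip x e) e \<in> {x\<in>V. ip x e = 0}"
      using that V e ee by (simp add: subspace_diff subspace_scale ip_diff_left ip_smul_left)
    then have "x - smul (ip x e) e \<in> span (set e')"
      using e' by (simp add: onb_iff)
    then show ?thesis by (auto simp: span_insert)
  qed
  ultimately show ?thesis by (auto simp: onb_iff)
qed

text \<open>
  Induction on \<open>dim V\<close>: an extremal pair \<open>e\<close>, \<open>f\<close> is prepended to a decomposition of the orthogonal
  complements. The list \<open>\<sigma>\<close> is decreasing because the maximum over the complements is at most the
  maximum over \<open>V\<close> and \<open>W\<close>.
\<close>

lemma exists_svd:
  assumes fin: "\<exists>B. finite B \<and> span B = UNIV" and "subspace V" "subspace W"
  shows "\<exists>e f \<sigma>. onb V e \<and> onb W f \<and> length \<sigma> = min (length e) (length f) \<and>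
    sorted_wrt (\<ge>) \<sigma> \<and> (\<forall>s\<in>set \<sigma>. 0 \<le> s) \<and>
    (\<forall>i<length e. \<forall>j<length f. ip (e ! i) (f ! j) = (if i = j then of_real (\<sigma> ! i) else 0))"
  using assms(2,3)
proof (induction "dim V" arbitrary: V W rule: less_induct)
  case less
  obtain v where v: "onb V v" using exists_onb[OF fin less.prems(1)] .
  obtain w where w: "onb W w" using exists_onb[OF fin less.prems(2)] .
  show ?case
  proof (cases "V = {0} \<or> W = {0}")
    case True
    then have "v = [] \<or> w = []" using onb_zero_iff[OF v] onb_zero_iff[OF w] by auto
    then show ?thesis using v w by (intro exI[of _ v] exI[of _ w] exI[of _ "[]"]) auto
  next
    case False
    with exists_extremal_pair[OF v w] obtain e f where e: "e \<in> V" "norm e = 1"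
      and f: "f \<in> W" "norm f = 1" and pos: "0 \<le> e \<bullet> f"
      and max: "\<And>x y. x \<in> V \<Longrightarrow> y \<in> W \<Longrightarrow> norm x = 1 \<Longrightarrow> norm y = 1 \<Longrightarrow> x \<bullet> y \<le> e \<bullet> f"
      by metis
    have orth_f: "ip x f = 0" if "x \<in> V" "ip x e = 0" for x
      using extremal_pair(1)[OF less.prems(1) e _ pos that] max f by blast
    have orth_e: "ip y e = 0" if "y \<in> W" "ip y f = 0" for y
      by (rule extremal_pair(1)[OF less.prems(2) f _ _ that])
        (use max e pos in \<open>auto simp: inner_commute[of _ e]\<close>)
    have ef: "ip e f = of_real (e \<bullet> f)"
      using extremal_pair(2)[OF less.prems(1) e _ pos] max f by blast
    define V' W' where "V' = {x\<in>V. ip x e = 0}" and "W' = {y\<in>W. ip y f = 0}"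
    have sub: "subspace V'" "subspace W'"
      using less.prems by (auto simp: V'_def W'_def subspace_def ip_add_left ip_smul_left)
    obtain v' where v': "onb V' v'" using exists_onb[OF fin sub(1)] .
    have "dim V = Suc (dim V')"
      using onb_dim[OF v'] onb_dim[OF onb_Cons_complement[OF less.prems(1) e]] v'
      by (simp add: V'_def)
    with less.hyps[OF _ sub] obtain e' f' \<sigma> where e': "onb V' e'" and f': "onb W' f'"
      and \<sigma>: "length \<sigma> = min (length e') (length f')" "sorted_wrt (\<ge>) \<sigma>" "\<forall>s\<in>set \<sigma>. 0 \<le> s"
      and ip: "\<And>i j. i < length e' \<Longrightarrow> j < length f' \<Longrightarrow>
        ip (e' ! i) (f' ! j) = (if i = j then of_real (\<sigma> ! i) else 0)"
      by auto
    have memV: "x \<in> V" "ip x e = 0" if "x \<in> set e'" for x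
      using onb_mem[OF e' that] by (auto simp: V'_def)
    have memW: "y \<in> W" "ip y f = 0" if "y \<in> set f'" for y
      using onb_mem[OF f' that] by (auto simp: W'_def)
    have "s \<le> e \<bullet> f" if s: "s \<in> set \<sigma>" for s
    proof -
      obtain i where i: "i < length e'" "i < length f'" "s = \<sigma> ! i"
        using s \<sigma>(1) by (auto simp: in_set_conv_nth)
      then have "s = e' ! i \<bullet> f' ! i" by (simp add: inner_eq_re ip re_of_real)
      also have "\<dots> \<le> e \<bullet> f"
        using i by (intro max memV memW norm_onb_nth[OF e'] norm_onb_nth[OF f']) auto
      finally show ?thesis .
    qed
    then have "sorted_wrt (\<ge>) ((e \<bullet> f) # \<sigma>)" using \<sigma>(2) by auto
    moreover have "onb V (e # e')" "onb W (f # f')"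
      using e' f' onb_Cons_complement[OF less.prems(1) e] onb_Cons_complement[OF less.prems(2) f]
      by (auto simp: V'_def W'_def)
    moreover have "ip ((e # e') ! i) ((f # f') ! j) = (if i = j then of_real (((e \<bullet> f) # \<sigma>) ! i) else 0)"
      if "i < length (e # e')" "j < length (f # f')" for i j
      using that ef ip memV memW orth_e orth_f
      by (auto simp: nth_Cons ip_eq_0_commute[of e] split: nat.splits)
    ultimately show ?thesis
      using \<sigma> pos by (intro exI[of _ "e # e'"] exI[of _ "f # f'"] exI[of _ "(e \<bullet> f) # \<sigma>"]) auto
  qed
qed

lemma exists_principal_decomposition:
  assumes "\<exists>B. finite B \<and> span B = UNIV" "subspace V" "subspace W"
  shows "\<exists>\<sigma> e f. principal_decomposition smul ip V W e f \<sigma>"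
proof -
  obtain e f \<sigma> where e: "onb V e" and f: "onb W f" and len: "length \<sigma> = min (length e) (length f)"
    and \<sigma>: "sorted_wrt (\<ge>) \<sigma>" "\<forall>s\<in>set \<sigma>. 0 \<le> s"
    and ip: "\<And>i j. i < length e \<Longrightarrow> j < length f \<Longrightarrow>
      ip (e ! i) (f ! j) = (if i = j then of_real (\<sigma> ! i) else 0)"
    using exists_svd[OF assms] by auto
  have "s \<le> 1" if s: "s \<in> set \<sigma>" for s
  proof -
    obtain i where i: "i < length e" "i < length f" "s = \<sigma> ! i"
      using s len by (auto simp: in_set_conv_nth)
    then have "s = e ! i \<bullet> f ! i" by (simp add: inner_eq_re ip re_of_real)
    also have "\<dots> \<le> 1"
      using norm_cauchy_schwarz[of "e ! i" "f ! i"] norm_onb_nth[OF e] norm_onb_nth[OF f] i by simp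
    finally show ?thesis .
  qed
  moreover have "orthogonal_projection ip W (e ! i) =
      (if i < length f then smul (of_real (\<sigma> ! i)) (f ! i) else 0)" if "i < length e" for i
  proof -
    have "orthogonal_projection ip W (e ! i) =
        (\<Sum>j<length f. smul (if i = j then of_real (\<sigma> ! i) else 0) (f ! j))"
      using that by (simp add: orthogonal_projection_eq_proj[OF f] proj_def ip)
    also have "\<dots> = (\<Sum>j<length f. if i = j then smul (of_real (\<sigma> ! i)) (f ! j) else 0)"
      by (intro sum.cong) auto
    finally show ?thesis by simp
  qed
  ultimately have "principal_decomposition smul ip V W e f \<sigma>"
    using e f len \<sigma> by (simp add: principal_decomposition_def)
  then show ?thesis by blast
qed

end

section \<open>Rotation invariance of Lebesgue measure\<close>

text \<open>The linear combination of the vectors of \<open>b\<close> with coefficients \<open>x\<close>.\<close>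

definition lincomb :: "'a::real_inner list \<Rightarrow> (nat \<Rightarrow> real) \<Rightarrow> 'a"
  where "lincomb b x = (\<Sum>i<length b. x i *\<^sub>R b ! i)"

text \<open>
  The coordinates of \<open>y\<close> with respect to the orthonormal list \<open>b\<close>, set to \<open>undefined\<close> beyond its
  length so as to lie in the space of \<open>coord_lborel (length b)\<close>.
\<close>

definition coords :: "'a::real_inner list \<Rightarrow> 'a \<Rightarrow> nat \<Rightarrow> real"
  where "coords b y = (\<lambda>i\<in>{..<length b}. y \<bullet> b ! i)"

lemma lincomb_in_span: "lincomb b x \<in> span (set b)"
  unfolding lincomb_def by (intro span_sum span_scale span_base) auto

lemma lincomb_coords:
  assumes "real_ip.orthonormal b" "y \<in> span (set b)"
  shows "lincomb b (coords b y) = y"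
  using real_ip.proj_eq_self[of b y] assms
  by (simp add: lincomb_def coords_def real_ip.proj_def span_raw_def)

lemma inner_lincomb_nth:
  assumes "real_ip.orthonormal b" "j < length b"
  shows "lincomb b x \<bullet> b ! j = x j"
proof -
  have "lincomb b x \<bullet> b ! j = (\<Sum>i<length b. x i * (if i = j then 1 else 0))"
    using assms by (auto simp: lincomb_def inner_sum_left real_ip.orthonormal_def intro!: sum.cong)
  also have "\<dots> = x j" using assms by (simp add: if_distrib cong: if_cong)
  finally show ?thesis .
qed

lemma coords_lincomb:
  assumes "real_ip.orthonormal b" "x \<in> space (coord_lborel (length b))"
  shows "coords b (lincomb b x) = x"
proof
  fix i show "coords b (lincomb b x) i = x i"
    using assms by (auto simp: coords_def inner_lincomb_nth space_PiM PiE_def extensional_def)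
qed

lemma lincomb_inner_self:
  assumes "real_ip.orthonormal b"
  shows "lincomb b x \<bullet> lincomb b x = (\<Sum>i<length b. (x i)\<^sup>2)"
proof -
  have "lincomb b x \<bullet> lincomb b x = (\<Sum>i<length b. x i * (lincomb b x \<bullet> b ! i))"
    by (subst (2) lincomb_def) (simp add: inner_sum_right)
  then show ?thesis by (simp add: inner_lincomb_nth[OF assms] power2_eq_square)
qed

lemma coords_in_space: "coords b y \<in> space (coord_lborel (length b))"
  by (auto simp: coords_def space_PiM)

lemma inj_on_lincomb:
  "real_ip.orthonormal b \<Longrightarrow> inj_on (lincomb b) (space (coord_lborel (length b)))"
  by (rule inj_on_inverseI) (rule coords_lincomb)

lemma measurable_coord_change:
  assumes "length c = length b"
  shows "(\<lambda>x. coords c (lincomb b x)) \<in> measurable (coord_lborel (length b)) (coord_lborel (length b))"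
  unfolding coords_def lincomb_def assms inner_sum_left inner_scaleR_left
  by (intro measurable_restrict) measurable

text \<open>
  The ball lies between the cubes \<open>[0, 1 / (n + 1)]\<^sup>n\<close> and \<open>[-1, 1]\<^sup>n\<close>.
\<close>

lemma unit_ball_coord_lborel:
  fixes n :: nat
  defines "D \<equiv> {x\<in>space (coord_lborel n). (\<Sum>i<n. (x i)\<^sup>2) \<le> 1}"
  shows "D \<in> sets (coord_lborel n)" "emeasure (coord_lborel n) D \<noteq> 0" "emeasure (coord_lborel n) D \<noteq> \<infinity>"
proof -
  let ?M = "coord_lborel n"
  interpret product_sigma_finite "\<lambda>i::nat. lborel :: real measure"
    by (rule product_sigma_finite_lborel)
  show D: "D \<in> sets ?M" unfolding D_def by measurable
  have box: "(\<Pi>\<^sub>E i\<in>{..<n}. {a..b}) \<in> sets ?M"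
    "emeasure ?M (\<Pi>\<^sub>E i\<in>{..<n}. {a..b}) = ennreal ((b - a) ^ n)" if "a \<le> b" for a b :: real
  proof -
    show "(\<Pi>\<^sub>E i\<in>{..<n}. {a..b}) \<in> sets ?M" by (intro sets_PiM_I_finite) auto
    have "emeasure ?M (\<Pi>\<^sub>E i\<in>{..<n}. {a..b}) = (\<Prod>i<n. emeasure lborel {a..b})"
      by (rule emeasure_PiM) auto
    then show "emeasure ?M (\<Pi>\<^sub>E i\<in>{..<n}. {a..b}) = ennreal ((b - a) ^ n)"
      using that by (simp add: ennreal_power)
  qed
  have "(\<Pi>\<^sub>E i\<in>{..<n}. {0..1 / (real n + 1)}) \<subseteq> D"
  proof
    fix x assume x: "x \<in> (\<Pi>\<^sub>E i\<in>{..<n}. {0..1 / (real n + 1)})"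
    have "(\<Sum>i<n. (x i)\<^sup>2) \<le> (\<Sum>i<n. 1 / (real n + 1))"
    proof (rule sum_mono)
      fix i assume "i \<in> {..<n}"
      then have xi: "0 \<le> x i" "x i \<le> 1 / (real n + 1)" using x by (auto simp: PiE_iff)
      have "1 / (real n + 1) \<le> 1" by simp
      with xi(2) have "x i \<le> 1" by (rule order_trans)
      from mult_mono[OF this xi(2) _ xi(1)] have "x i * x i \<le> 1 * (1 / (real n + 1))" by simp
      then show "(x i)\<^sup>2 \<le> 1 / (real n + 1)" by (simp add: power2_eq_square)
    qed
    also have "\<dots> \<le> 1" by simp
    finally show "x \<in> D" using x by (auto simp: D_def space_PiM PiE_iff)
  qed
  from emeasure_mono[OF this D] have "ennreal ((1 / (real n + 1)) ^ n) \<le> emeasure ?M D"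
    by (simp add: box)
  moreover have "0 < ennreal ((1 / (real n + 1)) ^ n)" by simp
  ultimately show "emeasure ?M D \<noteq> 0" by (metis leD)
  have "D \<subseteq> (\<Pi>\<^sub>E i\<in>{..<n}. {-1..1})"
  proof
    fix x assume x: "x \<in> D"
    have "x i \<in> {-1..1}" if "i < n" for i
    proof -
      have "(x i)\<^sup>2 \<le> (\<Sum>i<n. (x i)\<^sup>2)" using that by (intro member_le_sum) auto
      also have "\<dots> \<le> 1" using x by (simp add: D_def)
      finally show ?thesis by (simp add: abs_square_le_1 abs_le_iff)
    qed
    then show "x \<in> (\<Pi>\<^sub>E i\<in>{..<n}. {-1..1})" using x by (auto simp: D_def space_PiM PiE_iff)
  qed
  from emeasure_mono[OF this box(1)] have "emeasure ?M D \<le> ennreal (2 ^ n)"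
    by (simp add: box)
  then show "emeasure ?M D \<noteq> \<infinity>" by (auto simp: top_unique)
qed

text \<open>
  The change of coordinates between two orthonormal bases of the same space preserves the product
  Lebesgue measure: the image measure is translation invariant because the map is linear, and the
  unit ball is mapped onto itself.
\<close>

lemma distr_coord_change:
  assumes b: "real_ip.orthonormal b" and c: "real_ip.orthonormal c"
    and span: "span (set b) = span (set c)" and len: "length b = n" "length c = n"
  shows "distr (coord_lborel n) (coord_lborel n) (\<lambda>x. coords c (lincomb b x)) = coord_lborel n"
proof -
  let ?M = "coord_lborel n"
  define R where "R = (\<lambda>x. coords c (lincomb b x))"
  define R' where "R' = (\<lambda>x. coords b (lincomb c x))"
  have R[measurable]: "R \<in> measurable ?M ?M" "R' \<in> measurable ?M ?M"
    using measurable_coord_change[of c b] measurable_coord_change[of b c] len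
    by (auto simp: R_def R'_def)
  have lR: "lincomb c (R x) = lincomb b x" and lR': "lincomb b (R' x) = lincomb c x" for x
    using lincomb_coords[OF c, of "lincomb b x"] lincomb_coords[OF b, of "lincomb c x"]
      lincomb_in_span[of b x] lincomb_in_span[of c x] span
    by (simp_all add: R_def R'_def)
  have RR': "R (R' x) = x" "R' (R x) = x" if "x \<in> space ?M" for x
    using that coords_lincomb[OF c, of x] coords_lincomb[OF b, of x] len lR lR'
    by (simp_all add: R_def R'_def)
  have R_add: "R (\<lambda>i\<in>{..<n}. x i + y i) = (\<lambda>i\<in>{..<n}. R x i + R y i)" for x y
    using len by (auto simp: R_def coords_def lincomb_def inner_sum_left sum.distrib algebra_simps
        intro!: restrict_ext)
  have Rsp: "R x \<in> space ?M" "R' x \<in> space ?M" for x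
    using coords_in_space[of c] coords_in_space[of b] len by (auto simp: R_def R'_def)
  let ?\<nu> = "distr ?M ?M R"
  define D where "D = {x\<in>space ?M. (\<Sum>i<n. (x i)\<^sup>2) \<le> 1}"
  have "?\<nu> = ?M"
  proof (rule translation_invariant_eq_coord_lborel[where D = D])
    show "sets ?\<nu> = sets ?M" by simp
    \<comment> \<open>\<open>\<nu>\<close> is \<open>\<sigma>\<close>-finite because its image under the inverse map is Lebesgue measure.\<close>
    have "distr ?\<nu> ?M R' = distr ?M ?M (R' \<circ> R)"
      by (rule distr_distr) measurable
    also have "\<dots> = distr ?M ?M (\<lambda>x. x)"
      by (rule distr_cong) (auto simp: RR')
    also have "\<dots> = ?M" by (rule distr_id2) simp
    finally have "sigma_finite_measure (distr ?\<nu> ?M R')"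
      using sigma_finite_coord_lborel by simp
    then show "sigma_finite_measure ?\<nu>"
      by (rule sigma_finite_measure_distr) simp
    show D: "D \<in> sets ?M" "emeasure ?M D \<noteq> 0" "emeasure ?M D \<noteq> \<infinity>"
      unfolding D_def by (rule unit_ball_coord_lborel)+
    show "(\<lambda>i\<in>{..<n}. - x i) \<in> D \<longleftrightarrow> x \<in> D" if "x \<in> space ?M" for x
      using that by (auto simp: D_def space_PiM)
    have "R -` D \<inter> space ?M = D"
      using lincomb_inner_self[OF b] lincomb_inner_self[OF c] lR len Rsp
      by (auto simp: D_def) metis+
    then show "emeasure ?\<nu> D = emeasure ?M D"
      using D(1) by (simp add: emeasure_distr)
    fix a B assume a: "a \<in> space ?M" and B[measurable]: "B \<in> sets ?M"
    let ?shift = "\<lambda>a x. \<lambda>i\<in>{..<n}. x i + a i"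
    have shift[measurable]: "?shift t \<in> measurable ?M ?M" for t :: "nat \<Rightarrow> real"
      by (intro measurable_restrict) measurable
    have "R -` (?shift a -` B \<inter> space ?M) \<inter> space ?M = ?shift (R' a) -` (R -` B \<inter> space ?M) \<inter> space ?M"
      using Rsp RR'(1)[OF a] by (auto simp: R_add space_PiM)
    then show "emeasure ?\<nu> (?shift a -` B \<inter> space ?M) = emeasure ?\<nu> B"
      using emeasure_coord_lborel_shift[of "R -` B \<inter> space ?M" n "R' a"]
      by (simp add: emeasure_distr)
  qed
  then show ?thesis by (simp add: R_def)
qed

text \<open>
  An automorphism of a measurable space that scales the measure by \<open>k\<close> also does so on the
  completion.
\<close>

lemma image_completion:
  assumes T: "T \<in> measurable M M" and T': "T' \<in> measurable M M"
    and inv: "\<And>x. x \<in> space M \<Longrightarrow> T' (T x) = x" "\<And>x. x \<in> space M \<Longrightarrow> T (T' x) = x"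
    and scale: "\<And>A. A \<in> sets M \<Longrightarrow> emeasure M (T' -` A \<inter> space M) = k * emeasure M A"
    and A: "A \<in> sets (completion M)"
  shows "T ` A \<in> sets (completion M)"
    and "emeasure (completion M) (T ` A) = k * emeasure (completion M) A"
proof -
  obtain S N N' where SN: "A = S \<union> N" "N \<subseteq> N'" "N' \<in> null_sets M" "S \<in> sets M"
    using A by (rule sets_completionE)
  have image: "T ` B = T' -` B \<inter> space M" if "B \<in> sets M" for B
    using sets.sets_into_space[OF that] measurable_space[OF T] measurable_space[OF T'] inv
    by (auto simp: image_iff subset_iff) metis+
  have TS: "T ` S \<in> sets M" "emeasure M (T ` S) = k * emeasure M S"
    using SN(4) image[OF SN(4)] T' scale by auto
  have "T ` N' \<in> null_sets M"
    using SN(3) T' scale[of N'] image[of N'] by (auto simp: null_sets_def)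
  then have TN: "T ` N \<in> null_sets (completion M)"
    using SN(2) by (intro null_sets_completion_subset[of "T ` N" "T ` N'"] null_sets_completionI) auto
  have N: "N \<in> null_sets (completion M)"
    using SN by (intro null_sets_completion_subset[of N N'] null_sets_completionI)
  have TA: "T ` A = T ` S \<union> T ` N" using SN(1) by auto
  show "T ` A \<in> sets (completion M)"
    unfolding TA using TS(1) TN by auto
  have "emeasure (completion M) (T ` A) = emeasure (completion M) (T ` S)"
    unfolding TA using TS(1) TN by (intro emeasure_Un_null_set) auto
  moreover have "emeasure (completion M) A = emeasure (completion M) S"
    unfolding SN(1) using SN(4) N by (intro emeasure_Un_null_set) auto
  ultimately show "emeasure (completion M) (T ` A) = k * emeasure (completion M) A"
    using TS SN(4) by simp
qed

section \<open>Lebesgue measure on subspaces\<close>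

lemma lincomb_image_change_basis:
  assumes b: "real_ip.orthonormal b" and c: "real_ip.orthonormal c"
    and span: "span (set b) = span (set c)" and len: "length b = n" "length c = n"
    and A: "A \<in> sets (completion (coord_lborel n))"
  obtains A' where "A' \<in> sets (completion (coord_lborel n))" "lincomb b ` A = lincomb c ` A'"
    "emeasure (completion (coord_lborel n)) A' = emeasure (completion (coord_lborel n)) A"
proof -
  let ?M = "coord_lborel n"
  let ?R = "\<lambda>x. coords c (lincomb b x)" and ?R' = "\<lambda>x. coords b (lincomb c x)"
  have R: "?R \<in> measurable ?M ?M" "?R' \<in> measurable ?M ?M"
    using measurable_coord_change[of c b] measurable_coord_change[of b c] len by auto
  have lR: "lincomb c (?R x) = lincomb b x" "lincomb b (?R' x) = lincomb c x" for x
    using lincomb_coords[OF c, of "lincomb b x"] lincomb_coords[OF b, of "lincomb c x"]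
      lincomb_in_span[of b x] lincomb_in_span[of c x] span by simp_all
  have inv: "?R' (?R x) = x" "?R (?R' x) = x" if "x \<in> space ?M" for x
    using that coords_lincomb[OF c, of x] coords_lincomb[OF b, of x] len lR by simp_all
  have "emeasure ?M (?R' -` A \<inter> space ?M) = 1 * emeasure ?M A" if "A \<in> sets ?M" for A
    using emeasure_distr[OF R(2) that] distr_coord_change[OF c b span[symmetric] len(2,1)] by simp
  note im = image_completion[OF R inv this A]
  have "lincomb b ` A = lincomb c ` ?R ` A" using lR by (simp add: image_image)
  with im that show ?thesis by simp
qed

text \<open>The measure on a subspace can be computed in any orthonormal basis.\<close>

lemma subspace_lebesgue_eq:
  assumes b: "orthonormal_basis (*\<^sub>R) (\<bullet>) U b"
  shows "subspace_lebesgue U = embed_measure (completion (coord_lborel (length b))) (lincomb b)"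
proof -
  define c where "c = (SOME b. orthonormal_basis (*\<^sub>R) (\<bullet>) U b)"
  define n where "n = length b"
  let ?N = "completion (coord_lborel n)"
  have c: "orthonormal_basis (*\<^sub>R) (\<bullet>) U c"
    unfolding c_def using b by (rule someI)
  have "length c = n"
    using real_ip.onb_dim[OF b] real_ip.onb_dim[OF c] by (simp add: n_def)
  note len = \<open>length c = n\<close> n_def[symmetric]
  have on: "real_ip.orthonormal b" "real_ip.orthonormal c"
    and span: "span (set b) = span (set c)" "span (set c) = span (set b)"
    using b c by (auto simp: real_ip.onb_iff span_raw_def)
  have inj: "inj_on (lincomb b) (space ?N)" "inj_on (lincomb c) (space ?N)"
    using inj_on_lincomb[OF on(1)] inj_on_lincomb[OF on(2)] len by simp_all
  have "subspace_lebesgue U = embed_measure ?N (lincomb c)"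
    by (simp add: subspace_lebesgue_def c_def[symmetric] Let_def len lincomb_def[abs_def])
  also have "\<dots> = embed_measure ?N (lincomb b)"
  proof (rule measure_eqI)
    have "S \<in> sets (embed_measure ?N (lincomb b))" if "S \<in> sets (embed_measure ?N (lincomb c))" for S
      using that lincomb_image_change_basis[OF on(2,1) span(2) len]
      unfolding sets_embed_measure'[OF inj(1)] sets_embed_measure'[OF inj(2)] by blast
    moreover have "S \<in> sets (embed_measure ?N (lincomb c))" if "S \<in> sets (embed_measure ?N (lincomb b))" for S
      using that lincomb_image_change_basis[OF on(1,2) span(1) len(2,1)]
      unfolding sets_embed_measure'[OF inj(1)] sets_embed_measure'[OF inj(2)] by blast
    ultimately show "sets (embed_measure ?N (lincomb c)) = sets (embed_measure ?N (lincomb b))"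
      by blast
    fix S assume "S \<in> sets (embed_measure ?N (lincomb c))"
    then obtain A where A: "A \<in> sets ?N" "S = lincomb c ` A"
      unfolding sets_embed_measure'[OF inj(2)] by blast
    obtain A' where A': "A' \<in> sets ?N" "lincomb c ` A = lincomb b ` A'" "emeasure ?N A' = emeasure ?N A"
      using lincomb_image_change_basis[OF on(2,1) span(2) len A(1)] .
    have "emeasure (embed_measure ?N (lincomb c)) S = emeasure ?N A"
      unfolding A(2) by (rule emeasure_embed_measure_image'[OF inj(2) A(1)])
    also have "\<dots> = emeasure (embed_measure ?N (lincomb b)) S"
      unfolding A(2) A'(2) A'(3)[symmetric]
      by (rule emeasure_embed_measure_image'[OF inj(1) A'(1), symmetric])
    finally show "emeasure (embed_measure ?N (lincomb c)) S = emeasure (embed_measure ?N (lincomb b)) S" .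
  qed
  finally show ?thesis by (simp add: n_def)
qed

lemma
  assumes b: "orthonormal_basis (*\<^sub>R) (\<bullet>) U b"
  shows sets_subspace_lebesgue:
      "sets (subspace_lebesgue U) = {lincomb b ` A |A. A \<in> sets (completion (coord_lborel (length b)))}"
    and emeasure_subspace_lebesgue: "A \<in> sets (completion (coord_lborel (length b))) \<Longrightarrow>
      emeasure (subspace_lebesgue U) (lincomb b ` A) = emeasure (completion (coord_lborel (length b))) A"
proof -
  have "inj_on (lincomb b) (space (completion (coord_lborel (length b))))"
    using b inj_on_lincomb[of b] by (simp add: real_ip.onb_iff)
  then show "sets (subspace_lebesgue U) = {lincomb b ` A |A. A \<in> sets (completion (coord_lborel (length b)))}"
    "A \<in> sets (completion (coord_lborel (length b))) \<Longrightarrow>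
      emeasure (subspace_lebesgue U) (lincomb b ` A) = emeasure (completion (coord_lborel (length b))) A"
    unfolding subspace_lebesgue_eq[OF b]
    by (auto simp: sets_embed_measure' emeasure_embed_measure_image')
qed

text \<open>The unit cube spanned by an orthonormal basis has volume 1.\<close>

lemma exists_subspace_lebesgue_unit:
  assumes b: "orthonormal_basis (*\<^sub>R) (\<bullet>) U b"
  obtains S where "S \<in> fmeasurable (subspace_lebesgue U)" "measure (subspace_lebesgue U) S = 1"
proof -
  interpret product_sigma_finite "\<lambda>i::nat. lborel :: real measure"
    by (rule product_sigma_finite_lborel)
  let ?M = "coord_lborel (length b)"
  let ?Q = "\<Pi>\<^sub>E i\<in>{..<length b}. {0..1::real}"
  have Q: "?Q \<in> sets ?M" by (intro sets_PiM_I_finite) auto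
  have "emeasure ?M ?Q = (\<Prod>i<length b. emeasure lborel {0..1::real})"
    by (rule emeasure_PiM) auto
  then have "emeasure (completion ?M) ?Q = 1" using Q by simp
  with Q have "emeasure (subspace_lebesgue U) (lincomb b ` ?Q) = 1"
    by (subst emeasure_subspace_lebesgue[OF b]) auto
  moreover have "lincomb b ` ?Q \<in> sets (subspace_lebesgue U)"
    using Q unfolding sets_subspace_lebesgue[OF b] by blast
  ultimately show ?thesis
    by (intro that[of "lincomb b ` ?Q"]) (auto simp: fmeasurable_def measure_def)
qed

text \<open>
  A linear map that sends an orthonormal basis of \<open>V\<close> to positive multiples \<open>s i\<close> of an orthonormal
  list scales volume by the product of the \<open>s i\<close>.
\<close>

lemma diagonal_map_measure:
  assumes b: "orthonormal_basis (*\<^sub>R) (\<bullet>) V b" and c: "real_ip.orthonormal c"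
    and len: "length c = length b" and P: "linear P"
    and s: "\<And>i. i < length b \<Longrightarrow> s i > 0"
    and Pb: "\<And>i. i < length b \<Longrightarrow> P (b ! i) = s i *\<^sub>R c ! i"
  shows "dim (P ` V) = length b"
    and "S \<in> sets (subspace_lebesgue V) \<Longrightarrow>
      measure (subspace_lebesgue (P ` V)) (P ` S) = (\<Prod>i<length b. s i) * measure (subspace_lebesgue V) S"
proof -
  define n where "n = length b"
  let ?M = "coord_lborel n"
  have V: "V = span (set b)" using b by (simp add: real_ip.onb_iff span_raw_def)
  have "span (set c) = P ` V"
  proof
    have "c ! i \<in> P ` V" if "i < length b" for i
    proof
      show "c ! i = P ((1 / s i) *\<^sub>R b ! i)"
        using s[OF that] Pb[OF that] by (simp add: linear_cmul[OF P])
      show "(1 / s i) *\<^sub>R b ! i \<in> V" unfolding V using that by (intro span_scale span_base) simp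
    qed
    then show "span (set c) \<subseteq> P ` V"
      using len by (intro span_minimal linear_subspace_image[OF P]) (auto simp: in_set_conv_nth V)
    have "P (b ! i) \<in> span (set c)" if "i < length b" for i
      unfolding Pb[OF that] using that len by (intro span_scale span_base) simp
    then show "P ` V \<subseteq> span (set c)"
      unfolding V linear_span_image[OF P, symmetric]
      by (intro span_minimal) (auto simp: in_set_conv_nth)
  qed
  then have c': "orthonormal_basis (*\<^sub>R) (\<bullet>) (P ` V) c"
    using c by (simp add: real_ip.onb_iff span_raw_def)
  show "dim (P ` V) = length b"
    using real_ip.onb_dim[OF c'] len by (simp add: dim_raw_def)
  assume "S \<in> sets (subspace_lebesgue V)"
  then obtain A where A: "A \<in> sets (completion ?M)" "S = lincomb b ` A"
    unfolding sets_subspace_lebesgue[OF b] n_def by blast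
  define T where "T = (\<lambda>x. \<lambda>i\<in>{..<n}. s i * x i)"
  define T' where "T' = (\<lambda>x. \<lambda>i\<in>{..<n}. 0 + (1 / s i) * x i)"
  have meas: "T \<in> measurable ?M ?M" "T' \<in> measurable ?M ?M"
    unfolding T_def T'_def by (intro measurable_restrict; measurable)+
  have s': "s i > 0" if "i < n" for i using s that by (simp add: n_def)
  have inv: "T' (T x) = x" "T (T' x) = x" if "x \<in> space ?M" for x
    using that s' by (fastforce simp: T_def T'_def space_PiM PiE_def extensional_def fun_eq_iff)+
  let ?k = "ennreal (\<Prod>i<n. s i)"
  have scale: "emeasure ?M (T' -` B \<inter> space ?M) = ?k * emeasure ?M B" if "B \<in> sets ?M" for B
  proof -
    have "?k * ennreal (\<Prod>i<n. 1 / s i) = ennreal ((\<Prod>i<n. s i) * (\<Prod>i<n. 1 / s i))"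
      using s' by (intro ennreal_mult[symmetric] prod_nonneg) (auto simp: less_imp_le)
    also have "(\<Prod>i<n. s i) * (\<Prod>i<n. 1 / s i) = (\<Prod>i<n. s i * (1 / s i))"
      by (rule prod.distrib[symmetric])
    also have "\<dots> = (\<Prod>i<n. 1)" using s' by (intro prod.cong) (auto simp: less_imp_neq[symmetric])
    finally have "?k * ennreal (\<Prod>i<n. 1 / s i) = 1" by simp
    moreover have "ennreal (\<Prod>i<n. 1 / s i) * emeasure ?M (T' -` B \<inter> space ?M) = emeasure ?M B"
      unfolding T'_def using s' by (intro emeasure_coordinatewise_affine that) simp
    ultimately show ?thesis by (metis mult.assoc mult_1)
  qed
  note im = image_completion[OF meas inv scale A(1)]
  have "P (lincomb b x) = lincomb c (T x)" for x
    using len by (simp add: lincomb_def T_def n_def linear_sum[OF P] linear_cmul[OF P] Pb mult.commute)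
  then have PS: "P ` S = lincomb c ` (T ` A)" by (simp add: A(2) image_image)
  have "emeasure (subspace_lebesgue (P ` V)) (P ` S) = ?k * emeasure (subspace_lebesgue V) S"
    unfolding PS using A im emeasure_subspace_lebesgue[OF c', of "T ` A"]
      emeasure_subspace_lebesgue[OF b, of A] by (simp only: len n_def)
  then show "measure (subspace_lebesgue (P ` V)) (P ` S) = (\<Prod>i<length b. s i) * measure (subspace_lebesgue V) S"
    using prod_nonneg[of "{..<n}" s] s' by (simp add: measure_def enn2real_mult n_def less_imp_le)
qed

section \<open>The projection factor\<close>

context scalar_inner_space
begin

lemma linear_proj: "linear (proj e)"
  by (rule linearI) (simp_all add: proj_def ip_add_left ip_smul_left scale_left_distrib sum.distrib
    scale_sum_right flip: smul_of_real)

lemma proj_smul: "proj e (smul c x) = smul c (proj e x)"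
  by (simp add: proj_def ip_smul_left scale_sum_right)

lemma prod_realified_list: "(\<Prod>k<length \<sigma> * length units. \<sigma> ! (k div length units)) = (prod_list \<sigma> :: real) ^ length units"
proof -
  let ?m = "length units"
  have "(\<Prod>k<length \<sigma> * ?m. \<sigma> ! (k div ?m)) = (\<Prod>i<length \<sigma>. \<Prod>k=i * ?m..<i * ?m + ?m. \<sigma> ! (k div ?m))"
    by (rule prod.nat_group[symmetric])
  also have "\<dots> = (\<Prod>i<length \<sigma>. (\<sigma> ! i) ^ ?m)"
  proof (rule prod.cong[OF refl])
    fix i
    have "k div ?m = i" if "k \<in> {i * ?m..<i * ?m + ?m}" for k
      using that by (intro div_nat_eqI) (auto simp: mult.commute)
    then show "(\<Prod>k=i * ?m..<i * ?m + ?m. \<sigma> ! (k div ?m)) = (\<sigma> ! i) ^ ?m" by simp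
  qed
  also have "\<dots> = (prod_list \<sigma>) ^ ?m"
    by (simp add: prod_power_distrib prod.list_conv_set_nth lessThan_atLeast0)
  finally show ?thesis .
qed

text \<open>
  The value 0 for \<open>length e > length f\<close> agrees with reading the missing singular values as 0: then
  \<open>e ! length f\<close> is orthogonal to \<open>W\<close>.
\<close>

lemma projection_factor_eq_prod:
  assumes dec: "principal_decomposition smul ip V W e f \<sigma>"
  shows "projection_factor ip V W = (if length e \<le> length f then prod_list \<sigma> else 0) ^ length units"
proof -
  let ?m = "length units" and ?r = "(if length e \<le> length f then prod_list \<sigma> else 0)"
  have e: "onb V e" and f: "onb W f" and len: "length \<sigma> = min (length e) (length f)"
    and \<sigma>: "\<forall>s\<in>set \<sigma>. 0 \<le> s"
    and Pe: "\<And>i. i < length e \<Longrightarrow> proj f (e ! i) =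
       (if i < length f then smul (of_real (\<sigma> ! i)) (f ! i) else 0)"
    using dec orthogonal_projection_eq_proj[of W f] unfolding principal_decomposition_def by auto
  define b where "b = realify e"
  have b: "orthonormal_basis (*\<^sub>R) (\<bullet>) V b" unfolding b_def by (rule onb_realify[OF e])
  have dimV: "Real_Vector_Spaces.dim V = length b"
    using real_ip.onb_dim[OF b] by (simp add: dim_raw_def)
  have ratio: "subspace_volume (length b) (proj f ` V) (proj f ` S) / measure (subspace_lebesgue V) S
      = ?r ^ ?m"
    if S: "S \<in> sets (subspace_lebesgue V)" and nz: "measure (subspace_lebesgue V) S \<noteq> 0" for S
  proof (cases "length e \<le> length f \<and> 0 \<notin> set \<sigma>")
    case True
    then have len\<sigma>: "length \<sigma> = length e" using len by simp
    have "0 < \<sigma> ! i" if "i < length e" for i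
      using True \<sigma> that len\<sigma> by (metis nth_mem order_less_le)
    then have s: "0 < \<sigma> ! (k div ?m)" if "k < length b" for k
      using that by (simp add: b_def less_mult_imp_div_less)
    define c where "c = realify (take (length e) f)"
    have "orthonormal (take (length e) f)"
      using f True by (auto simp: onb_iff orthonormal_def)
    then have "onb (span (set (take (length e) f))) (take (length e) f)" by (simp add: onb_iff)
    from onb_realify[OF this] have c: "real_ip.orthonormal c"
      by (simp add: c_def real_ip.onb_iff)
    have lenc: "length c = length b" using True by (simp add: b_def c_def)
    have Pb: "proj f (b ! k) = \<sigma> ! (k div ?m) *\<^sub>R c ! k" if "k < length b" for k
    proof -
      have "k div ?m < length e" using that by (simp add: b_def less_mult_imp_div_less)
      then show ?thesis
        using that True by (simp add: b_def c_def realify_nth proj_smul Pe scale_left_commute flip: smul_of_real)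
    qed
    have "Real_Vector_Spaces.dim (proj f ` V) = length b"
      by (rule diagonal_map_measure(1)[OF b c lenc linear_proj s Pb])
    moreover have "measure (subspace_lebesgue (proj f ` V)) (proj f ` S) =
        (\<Prod>k<length b. \<sigma> ! (k div ?m)) * measure (subspace_lebesgue V) S"
      by (rule diagonal_map_measure(2)[OF b c lenc linear_proj s Pb S])
    moreover    have "(\<Prod>k<length b. \<sigma> ! (k div ?m)) = prod_list \<sigma> ^ ?m"
      using prod_realified_list[of \<sigma>] by (simp add: b_def len\<sigma>)
    ultimately show ?thesis
      using True nz by (simp add: subspace_volume_def)
  next
    case False
    \<comment> \<open>The projection kills some vector of the realified basis, so its image has smaller dimension.\<close>
    obtain i where i: "i < length e" "proj f (e ! i) = 0"
    proof (cases "length e \<le> length f")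
      case True
      then obtain i where "i < length \<sigma>" "\<sigma> ! i = 0" using False by (auto simp: in_set_conv_nth)
      then show ?thesis using that[of i] Pe[of i] True len by simp
    next
      case False
      then show ?thesis using that[of "length f"] Pe[of "length f"] by simp
    qed
    define v where "v = smul (units ! 0) (e ! i)"
    have v: "v \<in> set b" "proj f v = 0"
      using i length_units_pos by (simp_all add: v_def b_def smul_unit_in_realify proj_smul)
    have "Real_Vector_Spaces.dim (proj f ` V) \<le> card (proj f ` (set b - {v}))"
    proof (rule real_vector.dim_le_card)
      have "proj f ` set b \<subseteq> Real_Vector_Spaces.span (proj f ` (set b - {v}))"
      proof clarify
        fix x assume "x \<in> set b"
        then show "proj f x \<in> Real_Vector_Spaces.span (proj f ` (set b - {v}))"
          using v(2) by (cases "x = v") (auto simp: real_vector.span_zero intro: real_vector.span_base)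
      qed
      then have "Real_Vector_Spaces.span (proj f ` set b) \<subseteq> Real_Vector_Spaces.span (proj f ` (set b - {v}))"
        by (rule real_vector.span_minimal) (rule real_vector.subspace_span)
      then show "proj f ` V \<subseteq> Real_Vector_Spaces.span (proj f ` (set b - {v}))"
        using b linear_span_image[OF linear_proj, of f "set b"]
        by (auto simp: real_ip.onb_iff span_raw_def[symmetric])
    qed simp
    also have "\<dots> \<le> card (set b - {v})" by (rule card_image_le) simp
    also have "\<dots> < card (set b)" using v(1) by (intro psubset_card_mono) auto
    also have "\<dots> \<le> length b" by (rule card_length)
    finally have "subspace_volume (length b) (proj f ` V) (proj f ` S) = 0"
      by (simp add: subspace_volume_def)
    moreover have "?r = 0" using False by (auto simp: prod_list_zero_iff)
    ultimately show ?thesis using length_units_pos by simp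
  qed
  obtain S where S: "S \<in> fmeasurable (subspace_lebesgue V)" "measure (subspace_lebesgue V) S = 1"
    using exists_subspace_lebesgue_unit[OF b] .
  show ?thesis
    unfolding projection_factor_def Let_def orthogonal_projection_eq_proj[OF f] dimV
  proof (rule the_equality)
    show "\<forall>S\<in>fmeasurable (subspace_lebesgue V). subspace_volume (length b) V S \<noteq> 0 \<longrightarrow>
        ?r ^ ?m = subspace_volume (length b) (proj f ` V) (proj f ` S) / subspace_volume (length b) V S"
      using ratio by (auto simp: subspace_volume_def[of _ V] dimV fmeasurable_def)
    fix r assume "\<forall>S\<in>fmeasurable (subspace_lebesgue V). subspace_volume (length b) V S \<noteq> 0 \<longrightarrow>
        r = subspace_volume (length b) (proj f ` V) (proj f ` S) / subspace_volume (length b) V S"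
    with S have "r = subspace_volume (length b) (proj f ` V) (proj f ` S) / measure (subspace_lebesgue V) S"
      by (simp add: subspace_volume_def[of _ V] dimV)
    with ratio[of S] S show "r = ?r ^ ?m" by (simp add: fmeasurable_def)
  qed
qed

theorem projection_factor_eq_cos_grassmann_angle:
  assumes fin: "\<exists>B. finite B \<and> span B = UNIV" and V: "subspace V" and W: "subspace W"
  shows "projection_factor ip V W = cos (grassmann_angle smul ip V W) ^ length units"
proof -
  define \<sigma> where "\<sigma> = (SOME \<sigma>. \<exists>e f. principal_decomposition smul ip V W e f \<sigma>)"
  have "\<exists>e f. principal_decomposition smul ip V W e f \<sigma>"
    unfolding \<sigma>_def by (rule someI_ex[OF exists_principal_decomposition[OF assms]])
  then obtain e f where dec: "principal_decomposition smul ip V W e f \<sigma>" by blast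
  then have e: "onb V e" and f: "onb W f" and len: "length \<sigma> = min (length e) (length f)"
    and \<sigma>: "\<And>s. s \<in> set \<sigma> \<Longrightarrow> 0 \<le> s \<and> s \<le> 1"
    unfolding principal_decomposition_def by auto
  have "map (\<lambda>s. cos (arccos s)) \<sigma> = \<sigma>"
    using \<sigma> by (intro map_idI) (auto intro!: cos_arccos intro: order_trans[of "-1" 0])
  then have angles: "prod_list (map cos (principal_angles smul ip V W)) = prod_list \<sigma>"
    by (simp add: principal_angles_def \<sigma>_def[symmetric] o_def)
  have "0 \<le> prod_list \<sigma> \<and> prod_list \<sigma> \<le> 1"
    using \<sigma> by (induction \<sigma>) (auto intro: mult_le_one)
  then have cos: "cos (arccos (prod_list \<sigma>)) = prod_list \<sigma>" by (intro cos_arccos) auto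
  \<comment> \<open>For \<open>V = {0}\<close> the empty product gives \<open>cos 0 = 1\<close>; for \<open>W = {0} \<noteq> V\<close> the value 0 is \<open>cos (pi / 2)\<close>.\<close>
  have "cos (grassmann_angle smul ip V W) = (if length e \<le> length f then prod_list \<sigma> else 0)"
    using onb_zero_iff[OF e] onb_zero_iff[OF f] len
    by (auto simp: grassmann_angle_def angles cos onb_dim[OF e] onb_dim[OF f])
  then show ?thesis by (simp add: projection_factor_eq_prod[OF dec])
qed

end

lemma scalar_inner_space_complex: "scalar_inner_space (*\<^sub>C) cinner Re cnj [1, \<i>]"
proof
  fix x y z :: "'x::complex_inner" and c d :: complex and r :: real and i j :: nat
  show "of_real r *\<^sub>C x = r *\<^sub>R x" by (rule scaleC_of_real)
  show "cinner y x = cnj (cinner x y)" by (rule cinner_commute)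
  show "cinner (x + y) z = cinner x z + cinner y z" by (rule cinner_add_left)
  show "cinner (c *\<^sub>C x) y = c * cinner x y" by (rule cinner_scaleC_left)
  show "x \<bullet> y = Re (cinner x y)" by (rule inner_eq_Re_cinner)
  show "c = of_real (Re c)" if "cnj c = c" using that by (simp add: complex_eq_iff)
  show "Re ([1, \<i>] ! i * cnj ([1, \<i>] ! j)) = (if i = j then 1 else 0)"
    if "i < length [1, \<i>]" "j < length [1, \<i>]"
    using that by (auto simp: less_Suc_eq)
  show "c = (\<Sum>i<length [1, \<i>]. of_real (Re (c * cnj ([1, \<i>] ! i))) * [1, \<i>] ! i)"
    by (simp add: complex_eq_iff)
qed simp_all

theorem theorem2p9:
  fixes V W :: "'a::real_inner set"
    and V' W' :: "'b::complex_inner set"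
  shows "((\<exists>B::'a set. finite B \<and> span B = UNIV) \<and> subspace V \<and> subspace W \<longrightarrow>
            projection_factor (\<bullet>) V W = cos (grassmann_angle (*\<^sub>R) (\<bullet>) V W)) \<and>
         ((\<exists>B::'b set. finite B \<and> complex_vector.span B = UNIV) \<and>
            complex_vector.subspace V' \<and> complex_vector.subspace W' \<longrightarrow>
            projection_factor cinner V' W' = (cos (grassmann_angle (*\<^sub>C) cinner V' W'))\<^sup>2)"
  using real_ip.projection_factor_eq_cos_grassmann_angle[of V W]
    scalar_inner_space.projection_factor_eq_cos_grassmann_angle[OF scalar_inner_space_complex, of V' W']
  by (auto simp: span_raw_def subspace_raw_def numeral_2_eq_2)

end
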